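(* Let $p,q\ge 3$ be integers, let $G_{p,q}=\langle a,b,c\mid a^2=b^2=c^2=(ab)^q=(ac)^2=(bc)^p=1\rangle$ be the associated reflection group with fundamental triangle $F$, let $\bar G_{p,q}$ be its index-$2$ rotation subgroup, generated by $ab$ and $ac$, and let $S$ be a subgroup of $\bar G_{p,q}$ of (finite) index $k$ in $\bar G_{p,q}$. Here "perfect" means perfect with respect to the rotation group $\bar G_{p,q}$. Then: (1) $S$ induces a perfect $k$-colouring of the regular tiling $(q^p)$ if and only if $ab\in S$. (2) $S$ induces a perfect $k$-colouring of the Laves tiling $[p.q.p.q]$ if and only if $ac\in S$. (3) $S$ induces a perfect $k$-colouring of the regular tiling $(p^q)$ if and only if $bc\in S$.
   Context: Let $p,q\ge 3$ be integers and let $\mathbb{X}$ be the sphere $\mathbb{S}^2$, the Euclidean plane $\mathbb{R}^2$ or the hyperbolic plane $\mathbb{H}^2$ according to whether $\frac1p+\frac1q$ is $>$, $=$ or $<\frac12$. Let $F=F_{p,q}\subset\mathbb{X}$ be a closed geodesic triangle with angles $\frac{\pi}{2},\frac{\pi}{p},\frac{\pi}{q}$. Let $a$, $b$, $c$ denote the reflections in the lines spanned by the edges of $F$ opposite to the angles $\frac{\pi}{p}$, $\frac{\pi}{2}$, $\frac{\pi}{q}$, respectively. They generate the Coxeter group $G_{p,q}=\langle a,b,c\mid a^2=b^2=c^2=(ab)^q=(ac)^2=(bc)^p=1\rangle$ of isometries of $\mathbb{X}$, for which $F$ is a fundamental domain. The rotation group $\bar G_{p,q}$ is the subgroup of orientation-preserving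 elements of $G_{p,q}$. It has index $2$ and is generated by $ab$ and $ac$ (and contains $bc$). Both $F\cup aF$ and $F\cup bF$ are fundamental domains of $\bar G_{p,q}$. Tilings. $(p^q)$ is the regular tiling of $\mathbb{X}$ by regular $p$-gons, $q$ of them meeting at each vertex. It is positioned so that its tiles are the images under $G_{p,q}$ of the $p$-gon $\bigcup_{h\in\langle b,c\rangle}hF$. $(q^p)$ is the dual regular tiling by regular $q$-gons, $p$ meeting at each vertex; its tiles are the images under $G_{p,q}$ of the $q$-gon $\bigcup_{h\in\langle a,b\rangle}hF$. $[p.q.p.q]$ is the Laves tiling obtained from $(p^q)$ by taking as edges the line segments joining the centre of each $p$-gon to each of its vertices; its tiles are congruent quadrilaterals, namely the images under $G_{p,q}$ of $\bigcup_{h\in\langle a,c\rangle}hF=F\cup aF\cup cF\cup acF$. (The same tiling is written $[q.p.q.p]$ if $p>q$.) Colourings. A $k$-colouring of a tiling $X$ is a surjective map $c_X$ from the set of tiles of $X$ to $\{1,\dots,k\}$. It is perfect with respect to $\bar G_{p,q}$ if for every $h\in\bar G_{p,q}$ there is a permutation $\pi$ of $\{1,\dots,k\}$ with $c_X(hx)=\pi(c_X(x))$ for all tiles $x$. Induced colourings. Put $D=F\cup aF$ when considering $(q^p)$ or $[p.q.p.q]$, and $D=F\cup bF$ when considering $(p^q)$. The sets $fD$ ($f\in\bar G_{p,q}$) tile $\mathbb{X}$, are in bijection with $\bar G_{p,q}$, and each is contained in a single tile of the tiling considered. A subgroup $S\subseteq\bar G_{p,q}$ of index $k$, with left cosets $S_1=S,S_2,\dots,S_k$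 in $\bar G_{p,q}$, colours the sets $fD$ by giving $fD$ the colour $i$ if $f\in S_i$. $S$ is said to induce a perfect $k$-colouring of the tiling considered if, for each tile, all sets $fD$ contained in that tile have the same colour, and the resulting $k$-colouring of the tiles (each tile receiving this common colour) is perfect with respect to $\bar G_{p,q}$. *)

theory Defs
  imports
    "HOL-Analysis.Analysis"
    "HOL-Algebra.Bij"
    "HOL-Algebra.Left_Coset"
    "HOL-Algebra.Generated_Groups"
begin

section \<open>The sphere, the Euclidean plane and the hyperbolic plane\<close>

datatype geometry = Spherical | Euclidean | Hyperbolic

definition geometry_of :: "nat \<Rightarrow> nat \<Rightarrow> geometry" where
  "geometry_of p q =
     (if 1 / real p + 1 / real q > 1 / 2 then Spherical
      else if 1 / real p + 1 / real q = 1 / 2 then Euclidean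
      else Hyperbolic)"

definition lorentz :: "real^3 \<Rightarrow> real^3 \<Rightarrow> real" where
  "lorentz x y = x$1 * y$1 + x$2 * y$2 - x$3 * y$3"

text \<open>
  All three planes are realised in \<open>real^3\<close>: the unit sphere, the affine plane at height 1, and the
  upper sheet of the hyperboloid. In each model the geodesic lines are the nonempty intersections
  with linear planes.
\<close>

fun points :: "geometry \<Rightarrow> (real^3) set" where
  "points Spherical = sphere 0 1"
| "points Euclidean = {x. x$3 = 1}"
| "points Hyperbolic = {x. lorentz x x = -1 \<and> x$3 > 0}"

fun geo_dist :: "geometry \<Rightarrow> real^3 \<Rightarrow> real^3 \<Rightarrow> real" where
  "geo_dist Spherical x y = arccos (x \<bullet> y)"
| "geo_dist Euclidean x y = dist x y"
| "geo_dist Hyperbolic x y = arcosh (- lorentz x y)"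

definition geo_line :: "geometry \<Rightarrow> real^3 \<Rightarrow> real^3 \<Rightarrow> (real^3) set" where
  "geo_line g U V = points g \<inter> span {U, V}"

text \<open>The Riemannian metric on tangent vectors, which in the Euclidean model are horizontal.\<close>

fun tangent_form :: "geometry \<Rightarrow> real^3 \<Rightarrow> real^3 \<Rightarrow> real" where
  "tangent_form Spherical u v = u \<bullet> v"
| "tangent_form Euclidean u v = u \<bullet> v"
| "tangent_form Hyperbolic u v = lorentz u v"

text \<open>A tangent vector at \<open>U\<close> in the initial direction of the geodesic segment from \<open>U\<close> to \<open>V\<close>
  (the projection of \<open>V - U\<close> to the tangent plane at \<open>U\<close>).\<close>

fun direction :: "geometry \<Rightarrow> real^3 \<Rightarrow> real^3 \<Rightarrow> real^3" where
  "direction Spherical U V = V - (U \<bullet> V) *\<^sub>R U"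
| "direction Euclidean U V = V - U"
| "direction Hyperbolic U V = V + lorentz U V *\<^sub>R U"

text \<open>The angle at \<open>U\<close> between the segments from \<open>U\<close> to \<open>V\<close> and from \<open>U\<close> to \<open>W\<close>.\<close>

definition geo_angle :: "geometry \<Rightarrow> real^3 \<Rightarrow> real^3 \<Rightarrow> real^3 \<Rightarrow> real" where
  "geo_angle g U V W =
     (let v = direction g U V; w = direction g U W
      in arccos (tangent_form g v w / sqrt (tangent_form g v v * tangent_form g w w)))"

text \<open>
  Three points of \<open>points g\<close> lie on a common geodesic iff they are linearly dependent in \<open>real^3\<close>;
  the sign of the determinant is the orientation of a triple of points.
\<close>

definition orientation :: "real^3 \<Rightarrow> real^3 \<Rightarrow> real^3 \<Rightarrow> real" where
  "orientation x y z = sgn (det (vector [x, y, z] :: real^3^3))"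

definition nondegenerate_triangle :: "geometry \<Rightarrow> real^3 \<Rightarrow> real^3 \<Rightarrow> real^3 \<Rightarrow> bool" where
  "nondegenerate_triangle g U V W \<longleftrightarrow> {U, V, W} \<subseteq> points g \<and> orientation U V W \<noteq> 0"

definition geo_triangle :: "geometry \<Rightarrow> real^3 \<Rightarrow> real^3 \<Rightarrow> real^3 \<Rightarrow> (real^3) set" where
  "geo_triangle g U V W =
     {x \<in> points g. \<exists>r s t. r \<ge> 0 \<and> s \<ge> 0 \<and> t \<ge> 0 \<and> x = r *\<^sub>R U + s *\<^sub>R V + t *\<^sub>R W}"


section \<open>Isometries, reflections and rotations\<close>

definition isometry_group :: "geometry \<Rightarrow> (real^3 \<Rightarrow> real^3) monoid" where
  "isometry_group g = BijGroup (points g)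
     \<lparr>carrier := {f \<in> Bij (points g).
        \<forall>x\<in>points g. \<forall>y\<in>points g. geo_dist g (f x) (f y) = geo_dist g x y}\<rparr>"

definition is_reflection :: "geometry \<Rightarrow> (real^3) set \<Rightarrow> (real^3 \<Rightarrow> real^3) \<Rightarrow> bool" where
  "is_reflection g L f \<longleftrightarrow>
     f \<in> carrier (isometry_group g) \<and> f \<noteq> \<one>\<^bsub>isometry_group g\<^esub> \<and> (\<forall>x\<in>L. f x = x)"

definition orientation_preserving :: "geometry \<Rightarrow> (real^3 \<Rightarrow> real^3) \<Rightarrow> bool" where
  "orientation_preserving g f \<longleftrightarrow>
     (\<forall>x\<in>points g. \<forall>y\<in>points g. \<forall>z\<in>points g.
        orientation (f x) (f y) (f z) = orientation x y z)"

type_synonym isom = "real^3 \<Rightarrow> real^3"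

definition reflection_group :: "geometry \<Rightarrow> isom \<Rightarrow> isom \<Rightarrow> isom \<Rightarrow> isom monoid" where
  "reflection_group g a b c =
     isometry_group g \<lparr>carrier := generate (isometry_group g) {a, b, c}\<rparr>"

definition rotation_group :: "geometry \<Rightarrow> isom \<Rightarrow> isom \<Rightarrow> isom \<Rightarrow> isom monoid" where
  "rotation_group g a b c =
     isometry_group g
       \<lparr>carrier := {f \<in> carrier (reflection_group g a b c). orientation_preserving g f}\<rparr>"


section \<open>Tilings\<close>

text \<open>The images under the reflection group of the union of all \<open>h F\<close>, \<open>h\<close> in the subgroup
  generated by \<open>A\<close>.\<close>

definition tiling ::
  "geometry \<Rightarrow> isom \<Rightarrow> isom \<Rightarrow> isom \<Rightarrow> (real^3) set \<Rightarrow> isom set \<Rightarrow> (real^3) set set" where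
  "tiling g a b c F A =
     (\<lambda>f. f ` (\<Union>h\<in>generate (isometry_group g) A. h ` F)) ` carrier (reflection_group g a b c)"

text \<open>The regular tiling by \<open>p\<close>-gons, its dual by \<open>q\<close>-gons, and the Laves tiling.\<close>

definition tiling_pq where "tiling_pq g a b c F = tiling g a b c F {b, c}"
definition tiling_qp where "tiling_qp g a b c F = tiling g a b c F {a, b}"
definition tiling_laves where "tiling_laves g a b c F = tiling g a b c F {a, c}"


section \<open>Colourings\<close>

definition colouring :: "nat \<Rightarrow> (real^3) set set \<Rightarrow> ((real^3) set \<Rightarrow> nat) \<Rightarrow> bool" where
  "colouring k T col \<longleftrightarrow> col ` T = {1..k}"

definition perfect_colouring ::
  "isom monoid \<Rightarrow> nat \<Rightarrow> (real^3) set set \<Rightarrow> ((real^3) set \<Rightarrow> nat) \<Rightarrow> bool" where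
  "perfect_colouring \<Gamma> k T col \<longleftrightarrow>
     colouring k T col \<and>
     (\<forall>h\<in>carrier \<Gamma>. \<exists>\<pi>. \<pi> permutes {1..k} \<and> (\<forall>x\<in>T. col (h ` x) = \<pi> (col x)))"

text \<open>An enumeration \<open>S\<^sub>1 = S, \<dots>, S\<^sub>k\<close> of the left cosets of \<open>S\<close> in \<open>\<Gamma>\<close>.\<close>

definition coset_enumeration :: "isom monoid \<Rightarrow> isom set \<Rightarrow> nat \<Rightarrow> (nat \<Rightarrow> isom set) \<Rightarrow> bool" where
  "coset_enumeration \<Gamma> S k cs \<longleftrightarrow> bij_betw cs {1..k} (lcosets\<^bsub>\<Gamma>\<^esub> S) \<and> cs 1 = S"

text \<open>The colour of the set \<open>f D\<close>.\<close>

definition piece_colour :: "nat \<Rightarrow> (nat \<Rightarrow> isom set) \<Rightarrow> isom \<Rightarrow> nat" where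
  "piece_colour k cs f = (THE i. i \<in> {1..k} \<and> f \<in> cs i)"

text \<open>The common colour of all the sets \<open>f D\<close> contained in the tile \<open>x\<close>, if there is one.\<close>

definition induced_colour ::
  "isom monoid \<Rightarrow> (real^3) set \<Rightarrow> nat \<Rightarrow> (nat \<Rightarrow> isom set) \<Rightarrow> (real^3) set \<Rightarrow> nat" where
  "induced_colour \<Gamma> D k cs x =
     (THE i. \<exists>f\<in>carrier \<Gamma>. f ` D \<subseteq> x \<and> piece_colour k cs f = i)"

definition induces_perfect_colouring ::
  "isom monoid \<Rightarrow> (real^3) set \<Rightarrow> nat \<Rightarrow> (nat \<Rightarrow> isom set) \<Rightarrow> (real^3) set set \<Rightarrow> bool" where
  "induces_perfect_colouring \<Gamma> D k cs T \<longleftrightarrow>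
     (\<forall>x\<in>T. \<forall>f\<in>carrier \<Gamma>. \<forall>f'\<in>carrier \<Gamma>.
        f ` D \<subseteq> x \<and> f' ` D \<subseteq> x \<longrightarrow> piece_colour k cs f = piece_colour k cs f') \<and>
     perfect_colouring \<Gamma> k T (induced_colour \<Gamma> D k cs)"

end

theory Submission
  imports Defs
begin

text \<open>
  The group-theoretic content is short. Suppose that the images of the open triangle \<open>F\<close> under
  different elements of the reflection group do not meet. Let \<open>s\<close> and \<open>t\<close> be two of the three
  reflections, let \<open>H\<close> be the subgroup that they generate, and let \<open>U\<close> be the union of the sets
  \<open>h F\<close> with \<open>h\<close> in \<open>H\<close>, so that the tiles are the sets \<open>e U\<close>. A piece \<open>f D\<close> with \<open>D = F \<union> s F\<close>
  lies in the tile \<open>e U\<close> exactly if \<open>e\<inverse> f\<close> is in \<open>H\<close> (\<open>piece_in_tile_iff\<close>). Hence two pieces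
  \<open>f D\<close> and \<open>f' D\<close> of one tile differ by an element \<open>f\<inverse> f'\<close> of \<open>H\<close> that preserves orientation,
  that is, by a power of the rotation \<open>s t\<close>, and all powers occur. As \<open>f D\<close> and \<open>f' D\<close> have the same
  colour if and only if \<open>f\<inverse> f'\<close> is in \<open>S\<close>, the colours agree on every tile if and only if \<open>s t\<close>
  is in \<open>S\<close>. The resulting colouring is perfect because left translation permutes the left cosets
  of \<open>S\<close>. The three claims are the cases \<open>(s, t) = (a, b), (a, c), (b, c)\<close>.

  The geometric content is that images of the open triangle are disjoint. All three planes sit in
  \<open>real^3\<close> with their lines cut out by linear planes, and each of \<open>a\<close>, \<open>b\<close>, \<open>c\<close> is the restriction of
  a linear reflection \<open>x \<mapsto> x - 2 \<alpha>(x) \<nu>\<close> with \<open>\<alpha>(\<nu>) = 1\<close> (\<open>reflection_formula\<close>). With the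
  linear forms chosen positive on the interior of \<open>F\<close>, the angle conditions say that
  \<open>\<alpha>\<^sub>i(\<nu>\<^sub>j) = - cos (\<pi> / m)\<close> where \<open>\<pi> / m\<close> is the angle between the sides \<open>i\<close> and \<open>j\<close>
  (\<open>inward_angles\<close>). This is all that enters into the argument of Tits: by induction on the length
  of a word in the reflections, the image of the open chamber lies strictly on one side of each
  mirror, and which side it is can be read off from whether multiplication by that reflection
  shortens the word (\<open>reduced_halfspaces\<close>). The induction step reduces to the dihedral group of two
  mirrors, where positivity is that of \<open>sin (k \<pi> / m)\<close> for \<open>0 < k < m\<close>. Consequently a nontrivial
  element cannot move a point of the open chamber into the closed chamber
  (\<open>chamber_translate_trivial\<close>).
\<close>

section \<open>Reflections in linear hyperplanes and the simplicial chamber they bound\<close>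

text \<open>
  A representation by reflections in the sense of Tits: \<open>\<nu> i\<close> is the root of the reflection in the
  hyperplane \<open>\<alpha> i = 0\<close>, and the mirrors \<open>i\<close> and \<open>j\<close> meet at the angle \<open>\<pi> / m i j\<close>. The roots are
  part of the data, and not determined by an inner product, because in the Euclidean case the form
  is degenerate. The chamber is the open simplicial cone on which all \<open>\<alpha> i\<close> are positive.
\<close>

locale mirror_system =
  fixes \<alpha> :: "'i \<Rightarrow> 'v::real_vector \<Rightarrow> real" and \<nu> :: "'i \<Rightarrow> 'v" and m :: "'i \<Rightarrow> 'i \<Rightarrow> nat"
  assumes linear_form: "linear (\<alpha> i)"
    and form_root: "\<alpha> i (\<nu> i) = 1"
    and form_root_other: "i \<noteq> j \<Longrightarrow> \<alpha> i (\<nu> j) = - cos (pi / m i j)"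
    and order_ge_2: "i \<noteq> j \<Longrightarrow> m i j \<ge> 2"
    and order_sym: "m i j = m j i"
begin

definition mirror :: "'i \<Rightarrow> 'v \<Rightarrow> 'v" where
  "mirror i x = x - (2 * \<alpha> i x) *\<^sub>R \<nu> i"

primrec act :: "'i list \<Rightarrow> 'v \<Rightarrow> 'v" where
  "act [] x = x"
| "act (i # w) x = mirror i (act w x)"

lemma act_append: "act (u @ v) x = act u (act v x)"
  by (induction u) auto

lemma form_diff: "\<alpha> i (x - y) = \<alpha> i x - \<alpha> i y"
  using linear_form by (rule linear_diff)

lemma form_scale: "\<alpha> i (c *\<^sub>R x) = c * \<alpha> i x"
  using linear_scale[OF linear_form] by simp

lemma form_mirror_self: "\<alpha> i (mirror i x) = - \<alpha> i x"
  by (simp add: mirror_def form_diff form_scale form_root)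

lemma form_mirror_other:
  "i \<noteq> j \<Longrightarrow> \<alpha> i (mirror j x) = \<alpha> i x + 2 * cos (pi / m i j) * \<alpha> j x"
  by (simp add: mirror_def form_diff form_scale form_root_other)

lemma mirror_mirror: "mirror i (mirror i x) = x"
  unfolding mirror_def[of i "mirror i x"] form_mirror_self by (simp add: mirror_def)

primrec alternating :: "'i \<Rightarrow> 'i \<Rightarrow> nat \<Rightarrow> 'i list" where
  "alternating i j 0 = []"
| "alternating i j (Suc n) = i # alternating j i n"

lemma length_alternating [simp]: "length (alternating i j n) = n"
  by (induction n arbitrary: i j) auto

lemma set_alternating: "set (alternating i j n) \<subseteq> {i, j}"
  by (induction n arbitrary: i j) auto

lemma alternating_add:
  "alternating i j (a + b) =
     alternating i j a @ (if even a then alternating i j b else alternating j i b)"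
  by (induction a arbitrary: i j) auto

lemma sin_step: "2 * cos t * sin (real (Suc n) * t) - sin (real n * t) = sin (real (n + 2) * t)"
proof -
  have "sin (real (n + 2) * t) = sin (real (Suc n) * t + t)" "sin (real n * t) = sin (real (Suc n) * t - t)"
    by (simp_all add: algebra_simps)
  then show ?thesis unfolding sin_add sin_diff by (simp add: algebra_simps)
qed

text \<open>
  Two mirrors at the angle \<open>t\<close> generate rotations by multiples of \<open>2 t\<close>, so a form evaluated along
  an alternating word satisfies the recursion of the Chebyshev polynomials, whose solutions
  are sines of multiples of \<open>t\<close>. The parity of the length decides which of the two letters ends the
  word, and with it the form that receives the coefficient \<open>sin ((n + 1) t)\<close>.
\<close>

lemma form_alternating:
  assumes "i \<noteq> j"
  defines "t \<equiv> pi / m i j"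
  shows "sin t * \<alpha> j (act (alternating i j n) x) =
    sin (real (Suc n) * t) * \<alpha> (if even n then j else i) x +
    sin (real n * t) * \<alpha> (if even n then i else j) x"
  using assms(1) unfolding t_def
proof (induction n arbitrary: i j rule: less_induct)
  case (less n)
  define t where "t = pi / m i j"
  have t': "pi / m j i = t" by (simp add: t_def order_sym)
  show ?case
  proof (cases n)
    case 0
    then show ?thesis by simp
  next
    case (Suc k)
    define z where "z = act (alternating j i k) x"
    have zi: "sin t * \<alpha> i z = sin (real (Suc k) * t) * \<alpha> (if even k then i else j) x +
        sin (real k * t) * \<alpha> (if even k then j else i) x"
      using less.IH[of k j i] less.prems Suc by (simp add: z_def t')
    have n1: "\<alpha> j (act (alternating i j n) x) = \<alpha> j z + 2 * cos t * \<alpha> i z"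
      using less.prems by (simp add: Suc z_def form_mirror_other t')
    show ?thesis
    proof (cases k)
      case 0
      have "sin (2 * t) = 2 * sin t * cos t" by (rule sin_double)
      with n1 show ?thesis by (simp add: Suc 0 z_def t_def algebra_simps)
    next
      case (Suc l)
      have "\<alpha> j z = - \<alpha> j (act (alternating i j l) x)"
        by (simp add: z_def Suc form_mirror_self)
      moreover have "sin t * \<alpha> j (act (alternating i j l) x) =
        sin (real (Suc l) * t) * \<alpha> (if even l then j else i) x +
        sin (real l * t) * \<alpha> (if even l then i else j) x"
        using less.IH[of l i j] less.prems \<open>n = Suc k\<close> Suc by (simp add: t_def)
      ultimately have "sin t * \<alpha> j (act (alternating i j n) x) =
         2 * cos t * (sin (real (Suc k) * t) * \<alpha> (if even k then i else j) x +
        sin (real k * t) * \<alpha> (if even k then j else i) x) -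
        (sin (real (Suc l) * t) * \<alpha> (if even l then j else i) x +
        sin (real l * t) * \<alpha> (if even l then i else j) x)"
        unfolding n1 zi[symmetric] by (simp add: algebra_simps)
      also have "\<dots> = (2 * cos t * sin (real (Suc k) * t) - sin (real k * t)) * \<alpha> (if even k then i else j) x
         + (2 * cos t * sin (real (Suc l) * t) - sin (real l * t)) * \<alpha> (if even k then j else i) x"
        using Suc by (simp add: algebra_simps)
      finally show ?thesis unfolding sin_step using Suc \<open>n = Suc k\<close> by (simp add: t_def)
    qed
  qed
qed

lemma sin_multiple_pos:
  assumes "0 < k" "k < n" shows "sin (real k * (pi / real n)) > 0"
proof (rule sin_gt_zero)
  show "0 < real k * (pi / real n)" using assms by simp
  have "real k * pi < real n * pi" using assms by simp
  then show "real k * (pi / real n) < pi" using assms by (simp add: field_simps)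
qed

lemma sin_order_pos: "i \<noteq> j \<Longrightarrow> sin (pi / m i j) > 0"
  using sin_multiple_pos[of 1 "m i j"] order_ge_2[of i j] by simp

text \<open>
  Both coefficients in \<open>form_alternating\<close> are nonnegative as long as the word is shorter than the
  order \<open>m i j\<close>. The bound is sharp: at \<open>n = m i j\<close> the value is negative.
\<close>

lemma form_alternating_pos:
  assumes "i \<noteq> j" "n < m i j" "\<alpha> i x > 0" "\<alpha> j x > 0"
  shows "\<alpha> j (act (alternating i j n) x) > 0"
proof (cases "n = 0")
  case True
  then show ?thesis using assms by simp
next
  case False
  define t where "t = pi / m i j"
  have "sin (real n * t) > 0" using sin_multiple_pos[of n "m i j"] False assms by (simp add: t_def)
  moreover have "sin (real (Suc n) * t) \<ge> 0"
  proof (cases "Suc n = m i j")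
    case True
    then have "real (Suc n) * t = pi" unfolding t_def by simp
    then show ?thesis by (metis sin_pi order_refl)
  next
    case False
    then show ?thesis using sin_multiple_pos[of "Suc n" "m i j"] assms unfolding t_def
      by (metis Suc_lessI less_eq_real_def zero_less_Suc)
  qed
  ultimately have "sin t * \<alpha> j (act (alternating i j n) x) > 0"
    using form_alternating[OF assms(1), of n x] assms(3,4)
    unfolding t_def[symmetric] by (auto intro!: add_nonneg_pos)
  then show ?thesis using sin_order_pos[OF assms(1)] by (simp add: t_def zero_less_mult_iff)
qed

lemma act_in_root_plane:
  assumes "set w \<subseteq> {i, j}"
  shows "\<exists>c d. act w x = x + c *\<^sub>R \<nu> i + d *\<^sub>R \<nu> j"
  using assms
proof (induction w)
  case Nil
  have "act [] x = x + 0 *\<^sub>R \<nu> i + 0 *\<^sub>R \<nu> j" by simp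
  then show ?case by blast
next
  case (Cons l w)
  then obtain c d where *: "act w x = x + c *\<^sub>R \<nu> i + d *\<^sub>R \<nu> j" by auto
  define e where "e = 2 * \<alpha> l (act w x)"
  have "act (l # w) x = x + (c - e) *\<^sub>R \<nu> i + d *\<^sub>R \<nu> j" if "l = i"
    using * that by (simp add: mirror_def e_def algebra_simps)
  moreover have "act (l # w) x = x + c *\<^sub>R \<nu> i + (d - e) *\<^sub>R \<nu> j" if "l = j"
    using * that by (simp add: mirror_def e_def algebra_simps)
  ultimately show ?case using Cons.prems by auto
qed

lemma form_alternating_full:
  assumes "i \<noteq> j"
  shows "\<alpha> j (act (alternating i j (m i j)) x) = \<alpha> j (act (alternating j i (m i j)) x)"
proof -
  define t where "t = pi / m i j"
  obtain n where n: "m i j = Suc n" using order_ge_2[OF assms] by (cases "m i j") auto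
  have mt: "real (Suc n) * t = pi" by (simp add: t_def n)
  have s: "sin t > 0" using sin_order_pos[OF assms] by (simp add: t_def)
  have "real (Suc (Suc n)) * t = pi + t" "real n * t = pi - t"
    using mt by (simp_all add: algebra_simps)
  then have sins: "sin (real (Suc (Suc n)) * t) = - sin t" "sin (real n * t) = sin t"
    by simp_all
  have "sin t * \<alpha> j (act (alternating i j (Suc n)) x) = - sin t * \<alpha> (if even n then i else j) x"
    using form_alternating[OF assms, of "Suc n" x] unfolding t_def[symmetric] mt sins by simp
  moreover have "sin t * \<alpha> j (act (alternating i j n) x) = sin t * \<alpha> (if even n then i else j) x"
    using form_alternating[OF assms, of n x] unfolding t_def[symmetric] mt sins by simp
  moreover have "\<alpha> j (act (alternating j i (Suc n)) x) = - \<alpha> j (act (alternating i j n) x)"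
    by (simp add: form_mirror_self)
  ultimately have "sin t * \<alpha> j (act (alternating i j (Suc n)) x) = sin t * \<alpha> j (act (alternating j i (Suc n)) x)"
    by (metis minus_mult_left minus_mult_right)
  then show ?thesis using s unfolding n by simp
qed

text \<open>
  Both sides differ by a combination of the two roots, on which the forms \<open>\<alpha> i\<close> and \<open>\<alpha> j\<close> vanish by
  \<open>form_alternating_full\<close>. The Gram matrix of the two roots has determinant \<open>sin\<^sup>2 (\<pi> / m i j) \<noteq> 0\<close>,
  so the combination is zero.
\<close>

lemma braid_relation:
  assumes "i \<noteq> j"
  shows "act (alternating i j (m i j)) x = act (alternating j i (m i j)) x"
proof -
  define y z where "y = act (alternating i j (m i j)) x" and "z = act (alternating j i (m i j)) x"
  define C where "C = cos (pi / m i j)"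
  obtain c d where y: "y = x + c *\<^sub>R \<nu> i + d *\<^sub>R \<nu> j"
    using act_in_root_plane[OF set_alternating] unfolding y_def by blast
  have "set (alternating j i (m i j)) \<subseteq> {i, j}" using set_alternating by blast
  then obtain c' d' where z: "z = x + c' *\<^sub>R \<nu> i + d' *\<^sub>R \<nu> j"
    using act_in_root_plane unfolding z_def by blast
  have yz: "y - z = (c - c') *\<^sub>R \<nu> i - (d' - d) *\<^sub>R \<nu> j" by (simp add: y z algebra_simps)
  have "\<alpha> j (y - z) = 0" "\<alpha> i (y - z) = 0"
    using form_alternating_full[OF assms, of x] form_alternating_full[OF assms[symmetric], of x]
    by (simp_all add: y_def z_def form_diff order_sym[of j i])
  moreover have "\<alpha> i (y - z) = (c - c') + (d' - d) * C" "\<alpha> j (y - z) = - (c - c') * C - (d' - d)"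
    using assms assms[symmetric]
    by (simp_all add: yz form_diff form_scale form_root form_root_other order_sym[of j i] C_def
        left_diff_distrib)
  ultimately have e: "c - c' = - (d' - d) * C" "(d' - d) = - (c - c') * C"
    by linarith+
  then have "(d' - d) * (1 - C\<^sup>2) = 0" by algebra
  moreover have "1 - C\<^sup>2 > 0"
    using sin_order_pos[OF assms] unfolding C_def sin_squared_eq[symmetric] by simp
  ultimately have "d' - d = 0" by simp
  moreover from this have "c - c' = 0" using e(1) by simp
  ultimately have "y - z = 0" unfolding yz by simp
  then show ?thesis by (simp add: y_def z_def)
qed

text \<open>
  Lengths are compared among words with letters in \<open>I\<close>, because the length inside a dihedral
  subgroup and the length in the whole group are both used, and might differ a priori.
\<close>

definition reduced_in :: "'i set \<Rightarrow> 'i list \<Rightarrow> bool" where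
  "reduced_in I w \<longleftrightarrow> (\<forall>v. set v \<subseteq> I \<and> act v = act w \<longrightarrow> length w \<le> length v)"

lemma reduced_in_factor:
  assumes "reduced_in I (u @ w @ v)" "set u \<subseteq> I" "set v \<subseteq> I"
  shows "reduced_in I w"
  unfolding reduced_in_def
proof (intro allI impI)
  fix w' assume w': "set w' \<subseteq> I \<and> act w' = act w"
  then have "act (u @ w' @ v) = act (u @ w @ v)" by (simp add: fun_eq_iff act_append)
  moreover have "set (u @ w' @ v) \<subseteq> I" using w' assms by auto
  ultimately have "length (u @ w @ v) \<le> length (u @ w' @ v)" using assms(1) unfolding reduced_in_def by blast
  then show "length w \<le> length w'" by simp
qed

lemma reduced_no_repeat:
  assumes "set w \<subseteq> I" shows "\<not> reduced_in I (i # i # w)"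
proof
  assume "reduced_in I (i # i # w)"
  moreover have "act w = act (i # i # w)" by (simp add: fun_eq_iff mirror_mirror)
  ultimately show False using assms unfolding reduced_in_def by fastforce
qed

lemma reduced_dihedral_alternating:
  assumes "set u \<subseteq> {i, j}" "reduced_in {i, j} u"
  shows "u = alternating i j (length u) \<or> u = alternating j i (length u)"
  using assms
proof (induction u)
  case Nil
  then show ?case by simp
next
  case (Cons l u)
  have "reduced_in {i, j} u" using reduced_in_factor[of _ "[l]" u "[]"] Cons.prems by simp
  then have IH: "u = alternating i j (length u) \<or> u = alternating j i (length u)"
    using Cons by simp
  show ?case
  proof (cases u)
    case Nil
    then show ?thesis using Cons.prems by auto
  next
    case (Cons k v)
    have "l \<noteq> k" using reduced_no_repeat[of v "{i, j}" l] Cons.prems Cons by auto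
    moreover have "k \<in> {i, j}" "l \<in> {i, j}" using Cons.prems Cons by auto
    ultimately show ?thesis using IH Cons by auto
  qed
qed

text \<open>
  A longer alternating word contains a subword of length \<open>m i j\<close>, whose replacement by the braid
  relation brings two equal letters together, and these cancel.
\<close>

lemma reduced_alternating_le:
  assumes "i \<noteq> j" "reduced_in {i, j} (alternating i j n)"
  shows "n \<le> m i j"
proof (rule ccontr)
  assume "\<not> n \<le> m i j"
  then obtain d where d: "n = Suc (m i j + d)" by (metis not_le less_imp_Suc_add)
  obtain k where k: "m i j = Suc k" using order_ge_2[OF assms(1)] by (cases "m i j") auto
  define v where "v = (if even (m i j) then alternating j i d else alternating i j d)"
  define w where "w = alternating j i k @ v"
  have "alternating i j n = i # alternating j i (m i j) @ v"
    by (simp add: d alternating_add v_def)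
  then have "act (alternating i j n) x = mirror i (act (alternating i j (m i j)) (act v x))" for x
    using braid_relation[OF assms(1)] by (simp add: act_append)
  then have "act w = act (alternating i j n)"
    by (simp add: fun_eq_iff k w_def act_append mirror_mirror)
  moreover have "set w \<subseteq> {i, j}" using set_alternating[of i j] set_alternating[of j i] by (auto simp: w_def v_def)
  moreover have "length w < n" by (simp add: w_def v_def d k)
  ultimately show False using assms(2) unfolding reduced_in_def by fastforce
qed

text \<open>
  The dihedral case of \<open>reduced_halfspaces\<close>. A reduced word \<open>u\<close> is alternating of length at most
  \<open>m r s\<close>. If it begins with \<open>r\<close> and is shorter than \<open>m r s\<close>, the sine formula gives positivity. In
  the other cases \<open>u\<close> is equivalent to a word that begins with \<open>s\<close>, and the word without that first
  letter falls under the first case.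
\<close>

lemma dihedral_halfspaces:
  assumes "r \<noteq> s" "set u \<subseteq> {r, s}" "reduced_in {r, s} u"
  shows "(\<forall>x. \<alpha> r x > 0 \<longrightarrow> \<alpha> s x > 0 \<longrightarrow> \<alpha> s (act u x) > 0) \<or>
    ((\<forall>x. \<alpha> r x > 0 \<longrightarrow> \<alpha> s x > 0 \<longrightarrow> \<alpha> s (act u x) < 0) \<and>
     (\<exists>v. set v \<subseteq> {r, s} \<and> length v < length u \<and> act v = act (s # u)))"
proof -
  let ?n = "length u"
  have leave: ?thesis if "act u = act (alternating s r ?n)" "?n = Suc k" "k < m r s" for k
  proof -
    have "act u = act (s # alternating r s k)" using that by simp
    then have "act (alternating r s k) = act (s # u)" "\<alpha> s (act u x) = - \<alpha> s (act (alternating r s k) x)" for x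
      by (auto simp: fun_eq_iff mirror_mirror form_mirror_self)
    then show ?thesis
      using form_alternating_pos[OF assms(1) that(3)] set_alternating[of r s k] that(2)
      by (intro disjI2 conjI exI[of _ "alternating r s k"]) auto
  qed
  consider "u = alternating r s ?n" | "u = alternating s r ?n" "?n \<noteq> 0"
    using reduced_dihedral_alternating[OF assms(2,3)] by fastforce
  then show ?thesis
  proof cases
    case 1
    then have le: "?n \<le> m r s" using reduced_alternating_le[OF assms(1)] assms(3) by metis
    show ?thesis
    proof (cases "?n = m r s")
      case True
      obtain k where "?n = Suc k" using order_ge_2[OF assms(1)] True not0_implies_Suc[of ?n] by force
      moreover have "act u = act (alternating s r ?n)"
        using braid_relation[OF assms(1)] 1 True by (simp add: fun_eq_iff)
      ultimately show ?thesis using leave True by simp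
    next
      case False
      then show ?thesis using form_alternating_pos[OF assms(1), of ?n] le 1 by (metis le_neq_implies_less)
    qed
  next
    case 2
    have "reduced_in {s, r} (alternating s r ?n)" using assms(3) 2 by (simp add: insert_commute)
    then have "?n \<le> m r s" using reduced_alternating_le[of s r] assms(1) order_sym by metis
    then show ?thesis using leave[of "?n - 1"] 2 by simp
  qed
qed

text \<open>
  The theorem of Tits on the position of a chamber relative to a mirror. For a word \<open>w = r w'\<close> with
  \<open>r \<noteq> s\<close>, rewrite \<open>w\<close> without increasing its length as \<open>u v\<close> with \<open>u\<close> in the letters \<open>r\<close>, \<open>s\<close> and
  \<open>v\<close> as short as possible. Then \<open>v\<close> cannot be shortened by \<open>r\<close> or \<open>s\<close>, so by induction it maps the chamber to the wedge
  between these two mirrors, and the dihedral case applies to \<open>u\<close>.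
\<close>

theorem reduced_halfspaces:
  assumes "reduced_in UNIV w"
  shows "(\<forall>x. (\<forall>i. \<alpha> i x > 0) \<longrightarrow> \<alpha> s (act w x) > 0) \<or>
    ((\<forall>x. (\<forall>i. \<alpha> i x > 0) \<longrightarrow> \<alpha> s (act w x) < 0) \<and>
     (\<exists>v. length v < length w \<and> act v = act (s # w)))"
  using assms
proof (induction "length w" arbitrary: w s rule: less_induct)
  case less
  show ?case
  proof (cases w)
    case Nil
    then show ?thesis by simp
  next
    case (Cons r w')
    have red': "reduced_in UNIV w'" using reduced_in_factor[of _ "[r]" w' "[]"] less.prems Cons by simp
    have shorter: "\<not> length v < length w" if "act v = act w" for v
      using less.prems that unfolding reduced_in_def by fastforce
    show ?thesis
    proof (cases "r = s")
      case True
      have pos: "\<forall>x. (\<forall>i. \<alpha> i x > 0) \<longrightarrow> \<alpha> s (act w' x) > 0"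
        using less.hyps[of w' s] red' shorter Cons True by fastforce
      have "act w' = act (s # w)" by (simp add: Cons True fun_eq_iff mirror_mirror)
      moreover have "\<alpha> s (act w x) = - \<alpha> s (act w' x)" for x
        by (simp add: Cons True form_mirror_self)
      moreover have "length w' < length w" by (simp add: Cons)
      ultimately show ?thesis using pos by (metis neg_less_0_iff_less)
    next
      case False
      \<comment> \<open>\<open>dec u v\<close>: the word \<open>w\<close> can be written as \<open>u v\<close> with \<open>u\<close> in the dihedral subgroup, without increasing the length\<close>
      define dec where "dec = (\<lambda>u v. set u \<subseteq> {r, s} \<and> act (u @ v) = act w \<and> length u + length v \<le> length w)"
      have "dec [r] w'" using Cons by (simp add: dec_def)
      then obtain u v where uv: "dec u v" and min: "\<And>u' v'. dec u' v' \<Longrightarrow> length v \<le> length v'"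
        using ex_has_least_nat[of "\<lambda>(u, v). dec u v" "([r], w')" "\<lambda>(u, v). length v"] by auto
      have vlt: "length v < length w" using min[OF \<open>dec [r] w'\<close>] Cons by simp
      have uvred: "reduced_in UNIV (u @ v)"
        using uv less.prems unfolding dec_def reduced_in_def by fastforce
      have vred: "reduced_in UNIV v" using reduced_in_factor[of _ u v "[]"] uvred by simp
      have ured: "reduced_in {r, s} u"
        using reduced_in_factor[of UNIV "[]" u v] uvred by (auto simp: reduced_in_def)
      have vpos: "\<forall>x. (\<forall>i. \<alpha> i x > 0) \<longrightarrow> \<alpha> t (act v x) > 0" if t: "t \<in> {r, s}" for t
      proof (rule ccontr)
        assume "\<not> ?thesis"
        then obtain v' where v': "length v' < length v" "act v' = act (t # v)"
          using less.hyps[OF vlt vred] by blast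
        then have "dec (u @ [t]) v'"
          using uv t by (auto simp: dec_def act_append fun_eq_iff mirror_mirror)
        with min v' show False by fastforce
      qed
      have w: "act w x = act u (act v x)" for x using uv by (metis dec_def act_append)
      from dihedral_halfspaces[OF False _ ured] uv
      consider "\<forall>x. \<alpha> r x > 0 \<longrightarrow> \<alpha> s x > 0 \<longrightarrow> \<alpha> s (act u x) > 0"
        | u' where "\<forall>x. \<alpha> r x > 0 \<longrightarrow> \<alpha> s x > 0 \<longrightarrow> \<alpha> s (act u x) < 0"
          "length u' < length u" "act u' = act (s # u)"
        unfolding dec_def by blast
      then show ?thesis
      proof cases
        case 1
        then show ?thesis using vpos by (simp add: w)
      next
        case 2
        have "length (u' @ v) < length w" using 2 uv by (simp add: dec_def)
        moreover have "act (u' @ v) = act (s # w)" using 2 by (simp add: fun_eq_iff act_append w)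
        ultimately show ?thesis using 2 vpos by (auto simp: w)
      qed
    qed
  qed
qed

text \<open>
  If a shortest word for the given element had a first letter \<open>i\<close>, removing it would shorten the
  word, so the element would map the chamber to the negative side of mirror \<open>i\<close>.
\<close>

theorem chamber_translate_trivial:
  assumes pos: "\<And>i. \<alpha> i x > 0" and nonneg: "\<And>i. \<alpha> i (act w x) \<ge> 0"
  shows "act w = id"
proof -
  obtain v where v: "act v = act w" and min: "\<And>v'. act v' = act w \<Longrightarrow> length v \<le> length v'"
    using ex_has_least_nat[of "\<lambda>v. act v = act w" w length] by auto
  show ?thesis
  proof (cases v)
    case Nil
    then show ?thesis using v by (auto simp: fun_eq_iff)
  next
    case (Cons i u)
    have vred: "reduced_in UNIV v" using v min by (simp add: reduced_in_def)
    then have "reduced_in UNIV u" using reduced_in_factor[of _ "[i]" u "[]"] Cons by simp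
    moreover have "\<nexists>u'. length u' < length u \<and> act u' = act (i # u)"
      using min v Cons by fastforce
    ultimately have "\<alpha> i (act u x) > 0" using reduced_halfspaces pos by blast
    then have "\<alpha> i (act w x) < 0" unfolding v[symmetric] Cons by (simp add: form_mirror_self)
    with nonneg[of i] show ?thesis by simp
  qed
qed

end

section \<open>Reflections of the three planes as linear reflections\<close>

text \<open>
  The three models are treated together through the curvature \<open>\<kappa>\<close>. The Riemannian metric is the
  restriction to tangent vectors of \<open>u\<^sub>1 v\<^sub>1 + u\<^sub>2 v\<^sub>2 + \<kappa> u\<^sub>3 v\<^sub>3\<close>, and lines are given by
  covectors \<open>w\<close>, on which the dual quadratic form is \<open>w \<bullet> raise g w\<close>.
\<close>

fun curvature :: "geometry \<Rightarrow> real" where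
  "curvature Spherical = 1"
| "curvature Euclidean = 0"
| "curvature Hyperbolic = -1"

definition raise :: "geometry \<Rightarrow> real^3 \<Rightarrow> real^3" where
  "raise g w = vector [w$1, w$2, curvature g * w$3]"

lemmas coords3 = inner_vec_def sum_3 cross_components vector_3 raise_def lorentz_def

lemma raise_nth [simp]: "raise g w $ 1 = w$1" "raise g w $ 2 = w$2" "raise g w $ 3 = curvature g * w$3"
  by (simp_all add: raise_def)

lemma raise_scale: "raise g (c *\<^sub>R w) = c *\<^sub>R raise g w"
  by (simp add: vec_eq_iff forall_3)

lemma inner_raise_commute: "v \<bullet> raise g w = w \<bullet> raise g v"
  by (simp add: coords3)

lemma tangent_form_sym: "tangent_form g u v = tangent_form g v u"
  by (cases g) (simp_all add: coords3 inner_commute)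

lemma bilinear_tangent_form:
  "tangent_form g (u + v) w = tangent_form g u w + tangent_form g v w"
  "tangent_form g (u - v) w = tangent_form g u w - tangent_form g v w"
  "tangent_form g (c *\<^sub>R u) w = c * tangent_form g u w"
  "tangent_form g u (v + w) = tangent_form g u v + tangent_form g u w"
  "tangent_form g u (v - w) = tangent_form g u v - tangent_form g u w"
  "tangent_form g u (c *\<^sub>R w) = c * tangent_form g u w"
  by (cases g; simp add: coords3 algebra_simps)+

lemma points_Spherical_iff: "x \<in> points Spherical \<longleftrightarrow> x$1*x$1 + x$2*x$2 + x$3*x$3 = 1"
  by (simp add: norm_eq_sqrt_inner inner_vec_def sum_3)

text \<open>
  A plane through a point of the model cuts out a line, and its covector therefore has positive
  square. In the hyperbolic case this is the fact that a vector orthogonal to a timelike vector is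
  spacelike.
\<close>

lemma inner_raise_pos:
  assumes "U \<in> points g" "w \<bullet> U = 0" "w \<noteq> 0"
  shows "w \<bullet> raise g w > 0"
proof (cases g)
  case Spherical
  then have "raise g w = w" by (simp add: vec_eq_iff forall_3)
  then show ?thesis using assms(3) by simp
next
  case Euclidean
  then have "w$1 \<noteq> 0 \<or> w$2 \<noteq> 0" using assms by (auto simp: vec_eq_iff forall_3 inner_vec_def sum_3)
  then show ?thesis using Euclidean
    by (auto simp: inner_vec_def sum_3 add_pos_nonneg add_nonneg_pos zero_less_mult_iff less_le)
next
  case Hyperbolic
  let ?s = "(w$1)\<^sup>2 + (w$2)\<^sup>2" and ?r = "(U$1)\<^sup>2 + (U$2)\<^sup>2"
  have U: "(U$3)\<^sup>2 = 1 + ?r"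
    using assms(1) Hyperbolic by (simp add: lorentz_def power2_eq_square)
  have w3: "w$3 * U$3 = - (w$1 * U$1 + w$2 * U$2)" using assms(2) by (simp add: inner_vec_def sum_3)
  have "(w$3)\<^sup>2 * (U$3)\<^sup>2 = (w$1 * U$1 + w$2 * U$2)\<^sup>2"
    unfolding power_mult_distrib[symmetric] w3 by (simp add: power2_eq_square algebra_simps)
  also have "\<dots> \<le> ?s * ?r"
    using zero_le_power2[of "w$1 * U$2 - w$2 * U$1"] by (simp add: power2_eq_square algebra_simps)
  finally have le: "(w$3)\<^sup>2 * (1 + ?r) \<le> ?s * ?r" by (simp add: U)
  have "?s > (w$3)\<^sup>2"
  proof (rule ccontr)
    assume "\<not> ?thesis"
    then have *: "?s \<le> (w$3)\<^sup>2" by simp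
    then have "?s * (1 + ?r) \<le> (w$3)\<^sup>2 * (1 + ?r)" by (intro mult_right_mono) auto
    with le have "?s \<le> 0" by (simp add: distrib_left)
    then have "w$1 = 0" "w$2 = 0"
      using zero_le_power2[of "w$1"] zero_le_power2[of "w$2"] by (auto simp: sum_power2_le_zero_iff)
    moreover from this le have "(w$3)\<^sup>2 * (1 + ?r) \<le> 0" by simp
    moreover have "1 + ?r > 0" using zero_le_power2[of "U$1"] zero_le_power2[of "U$2"] by linarith
    ultimately have "w$3 = 0"
      by (metis mult_le_0_iff not_le power2_less_eq_zero_iff)
    with \<open>w$1 = 0\<close> \<open>w$2 = 0\<close> assms(3) show False by (simp add: vec_eq_iff forall_3)
  qed
  then show ?thesis using Hyperbolic by (simp add: inner_vec_def sum_3 power2_eq_square)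
qed

text \<open>
  The initial directions of two segments at \<open>U\<close> make the same angle as the normals of the lines that
  carry these segments, since the latter arise by a quarter turn of the tangent plane at \<open>U\<close>.
\<close>

lemma direction_forms:
  assumes "U \<in> points g" "V \<in> points g" "W \<in> points g"
  shows "tangent_form g (direction g U V) (direction g U W)
    = cross3 U V \<bullet> raise g (cross3 U W)"
proof (cases g)
  case Spherical
  have "U$1*U$1 + U$2*U$2 + U$3*U$3 = 1" using assms(1) unfolding Spherical points_Spherical_iff .
  then show ?thesis unfolding Spherical by (simp add: coords3) algebra
next
  case Euclidean
  then show ?thesis using assms by (simp add: coords3 algebra_simps)
next
  case Hyperbolic
  have "U$1*U$1 + U$2*U$2 - U$3*U$3 = -1" using assms(1) by (simp add: Hyperbolic lorentz_def)
  then show ?thesis unfolding Hyperbolic by (simp add: coords3) algebra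
qed

text \<open>
  The strict Cauchy-Schwarz inequality for the normals of two lines through \<open>U\<close> in quantitative
  form.
\<close>

lemma gram_cross:
  fixes U V W :: "real^3"
  assumes "U \<in> points g"
  defines "v \<equiv> cross3 U V" and "w \<equiv> cross3 U W"
  shows "(v \<bullet> raise g v) * (w \<bullet> raise g w) - (v \<bullet> raise g w)\<^sup>2 = (det (vector [U, V, W] :: real^3^3))\<^sup>2"
proof (cases g)
  case Spherical
  have "U$1*U$1 + U$2*U$2 + U$3*U$3 = 1" using assms(1) unfolding Spherical points_Spherical_iff .
  then show ?thesis unfolding Spherical v_def w_def by (simp add: coords3 det_3) algebra
next
  case Euclidean
  then show ?thesis using assms(1) unfolding v_def w_def
    by (simp add: coords3 det_3 power2_eq_square algebra_simps)
next
  case Hyperbolic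
  have "U$1*U$1 + U$2*U$2 - U$3*U$3 = -1" using assms(1) by (simp add: Hyperbolic lorentz_def)
  then show ?thesis unfolding Hyperbolic v_def w_def by (simp add: coords3 det_3) algebra
qed

text \<open>
  The quotient in the definition of the angle has absolute value at most \<open>1\<close> by \<open>gram_cross\<close>, so the
  arc cosine in that definition can be inverted.
\<close>

lemma cos_geo_angle:
  assumes "U \<in> points g" "V \<in> points g" "W \<in> points g" "orientation U V W \<noteq> 0"
  defines "v \<equiv> cross3 U V" and "w \<equiv> cross3 U W"
  shows "cos (geo_angle g U V W) = (v \<bullet> raise g w) / (sqrt (v \<bullet> raise g v) * sqrt (w \<bullet> raise g w))"
proof -
  let ?t = "(v \<bullet> raise g w) / sqrt ((v \<bullet> raise g v) * (w \<bullet> raise g w))"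
  have d: "det (vector [U, V, W] :: real^3^3) \<noteq> 0" using assms(4) by (auto simp: orientation_def sgn_if)
  have "det (vector [U, V, W] :: real^3^3) = v \<bullet> W" "det (vector [U, V, W] :: real^3^3) = - (w \<bullet> V)"
    by (simp_all add: v_def w_def coords3 det_3 algebra_simps)
  then have "v \<noteq> 0" "w \<noteq> 0" using d by auto
  then have pos: "v \<bullet> raise g v > 0" "w \<bullet> raise g w > 0"
    by (auto intro!: inner_raise_pos[OF assms(1)] simp: v_def w_def dot_cross_self)
  have "(v \<bullet> raise g w)\<^sup>2 < (v \<bullet> raise g v) * (w \<bullet> raise g w)"
    using gram_cross[OF assms(1), of V W] d zero_less_power2[of "det (vector [U, V, W] :: real^3^3)"]
    unfolding v_def[symmetric] w_def[symmetric] by linarith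
  then have "\<bar>v \<bullet> raise g w\<bar> < sqrt ((v \<bullet> raise g v) * (w \<bullet> raise g w))"
    by (metis real_less_rsqrt power2_abs)
  then have "\<bar>?t\<bar> \<le> 1" using pos by (simp add: abs_divide abs_mult)
  moreover have "geo_angle g U V W = arccos ?t"
    using assms(1-3) by (simp add: geo_angle_def direction_forms v_def w_def Let_def)
  ultimately show ?thesis by (simp add: cos_arccos_abs real_sqrt_mult)
qed

definition reflect :: "geometry \<Rightarrow> real^3 \<Rightarrow> real^3 \<Rightarrow> real^3" where
  "reflect g w x = x - (2 * (w \<bullet> x)) *\<^sub>R raise g w"

lemma orientation_reflect:
  assumes "w \<bullet> raise g w = 1"
  shows "orientation (reflect g w x) (reflect g w y) (reflect g w z) = - orientation x y z"
proof -
  \<comment> \<open>the determinant is alternating, so only the terms with at most one factor \<open>n\<close> survive\<close>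
  have expand: "det (vector [x - a *\<^sub>R n, y - b *\<^sub>R n, z - c *\<^sub>R n] :: real^3^3) =
    det (vector [x, y, z] :: real^3^3) - a * det (vector [n, y, z] :: real^3^3)
      - b * det (vector [x, n, z] :: real^3^3) - c * det (vector [x, y, n] :: real^3^3)" for a b c n
    by (simp add: det_3 algebra_simps)
  \<comment> \<open>the linear form \<open>w\<close> applied to Cramer's expansion of \<open>n\<close> in terms of \<open>x\<close>, \<open>y\<close>, \<open>z\<close>\<close>
  have cramer: "(w \<bullet> x) * det (vector [n, y, z] :: real^3^3)
      + (w \<bullet> y) * det (vector [x, n, z] :: real^3^3) + (w \<bullet> z) * det (vector [x, y, n] :: real^3^3)
    = (w \<bullet> n) * det (vector [x, y, z] :: real^3^3)" for n
    by (simp add: det_3 inner_vec_def sum_3 algebra_simps)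
  have "det (vector [reflect g w x, reflect g w y, reflect g w z] :: real^3^3)
    = det (vector [x, y, z] :: real^3^3) - 2 * ((w \<bullet> raise g w) * det (vector [x, y, z] :: real^3^3))"
    unfolding reflect_def expand cramer[symmetric] by (simp add: algebra_simps)
  then have "det (vector [reflect g w x, reflect g w y, reflect g w z] :: real^3^3)
    = - det (vector [x, y, z] :: real^3^3)"
    by (simp add: assms)
  then show ?thesis by (simp add: orientation_def sgn_minus)
qed

text \<open>
  The reversed Cauchy-Schwarz inequality for future timelike unit vectors. It puts the argument of
  \<open>arcosh\<close> in the definition of the hyperbolic distance into the domain on which \<open>arcosh\<close> is
  injective.
\<close>

lemma lorentz_ge_1:
  assumes "x \<in> points Hyperbolic" "y \<in> points Hyperbolic"
  shows "- lorentz x y \<ge> 1"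
proof -
  have x: "(x$3)\<^sup>2 = 1 + (x$1)\<^sup>2 + (x$2)\<^sup>2" "x$3 > 0" and y: "(y$3)\<^sup>2 = 1 + (y$1)\<^sup>2 + (y$2)\<^sup>2" "y$3 > 0"
    using assms by (simp_all add: lorentz_def power2_eq_square)
  have ge1: "x$3 * y$3 \<ge> 1"
  proof -
    have "x$3 \<ge> 1" "y$3 \<ge> 1" using x y by (auto intro!: power2_le_imp_le[of 1])
    then show ?thesis using mult_mono[of 1 "x$3" 1 "y$3"] by simp
  qed
  have "(x$1*y$1 + x$2*y$2)\<^sup>2 \<le> ((x$1)\<^sup>2 + (x$2)\<^sup>2) * ((y$1)\<^sup>2 + (y$2)\<^sup>2)"
    using zero_le_power2[of "x$1 * y$2 - x$2 * y$1"] by (simp add: power2_eq_square algebra_simps)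
  also have "\<dots> = ((x$3)\<^sup>2 - 1) * ((y$3)\<^sup>2 - 1)" by (simp add: x(1) y(1))
  also have "\<dots> \<le> (x$3 * y$3 - 1)\<^sup>2"
    using zero_le_power2[of "x$3 - y$3"] by (simp add: power2_eq_square algebra_simps)
  finally have "x$1*y$1 + x$2*y$2 \<le> x$3 * y$3 - 1"
    by (rule power2_le_imp_le) (use ge1 in simp)
  then show ?thesis by (simp add: lorentz_def)
qed

text \<open>
  In all three models the distance determines the square of the chord \<open>x - y\<close> in the ambient space
  with respect to \<open>tangent_form\<close>. Unlike the distance, this square is polynomial in \<open>x\<close> and \<open>y\<close>.
\<close>

lemma chord_eq_if_geo_dist_eq:
  assumes "x \<in> points g" "y \<in> points g" "x' \<in> points g" "y' \<in> points g"
    and "geo_dist g x y = geo_dist g x' y'"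
  shows "tangent_form g (x - y) (x - y) = tangent_form g (x' - y') (x' - y')"
proof (cases g)
  case Spherical
  have "\<bar>u \<bullet> v\<bar> \<le> 1" if "u \<in> points g" "v \<in> points g" for u v
    using Cauchy_Schwarz_ineq2[of u v] that Spherical by simp
  then have "x \<bullet> y = x' \<bullet> y'"
    using assms Spherical arccos_eq_iff[of "x \<bullet> y" "x' \<bullet> y'"] by simp
  moreover have "u \<bullet> u = 1" if "u \<in> points g" for u
    using that Spherical by (simp add: norm_eq_1)
  ultimately show ?thesis using assms(1-4) Spherical
    by (simp add: inner_diff_left inner_diff_right inner_commute)
next
  case Euclidean
  then show ?thesis using assms(5) by (simp add: dist_norm norm_eq)
next
  case Hyperbolic
  have cosh_dist: "cosh (geo_dist g u v) = - lorentz u v" if "u \<in> points g" "v \<in> points g" for u v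
    using cosh_arcosh_real[OF lorentz_ge_1] that Hyperbolic by simp
  have "lorentz x y = lorentz x' y'"
    using cosh_dist[OF assms(1,2)] cosh_dist[OF assms(3,4)] assms(5) by simp
  moreover have "lorentz u u = -1" if "u \<in> points g" for u using that Hyperbolic by simp
  ultimately show ?thesis using assms(1-4) Hyperbolic bilinear_tangent_form[of Hyperbolic] tangent_form_sym[of Hyperbolic]
    by simp
qed

text \<open>
  In the Euclidean model \<open>raise\<close> drops the third coordinate of \<open>w\<close>, which does no harm because the
  third coordinate of \<open>x - y\<close> vanishes.
\<close>

lemma tangent_form_raise:
  assumes "x \<in> points g" "y \<in> points g"
  shows "tangent_form g (x - y) (raise g w) = w \<bullet> (x - y)"
  using assms by (cases g) (simp_all add: coords3 algebra_simps)

lemma tangent_form_raise_raise: "tangent_form g (raise g w) (raise g w) = w \<bullet> raise g w"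
  by (cases g) (simp_all add: coords3)

text \<open>
  Two points at the same distances from \<open>U\<close> and from \<open>V\<close> differ by a vector perpendicular to the line
  through \<open>U\<close> and \<open>V\<close>. The statement is multiplied by the square of the normal to be polynomial.
\<close>

lemma chord_parallel_raise:
  assumes "U \<in> points g" "V \<in> points g" "x \<in> points g" "z \<in> points g"
    and "tangent_form g (z - U) (z - U) = tangent_form g (x - U) (x - U)"
    and "tangent_form g (z - V) (z - V) = tangent_form g (x - V) (x - V)"
  defines "w \<equiv> cross3 U V"
  shows "(w \<bullet> raise g w) *\<^sub>R (z - x) = (w \<bullet> (z - x)) *\<^sub>R raise g w"
proof (cases g)
  case Spherical
  have "d \<bullet> d = 1" if "d \<in> points g" for d using that Spherical by (simp add: norm_eq_1)
  then have "z \<bullet> U = x \<bullet> U" "z \<bullet> V = x \<bullet> V"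
    using assms(1-6) Spherical by (simp_all add: inner_diff_left inner_diff_right inner_commute)
  then show ?thesis unfolding w_def Spherical
    by (simp add: coords3 vec_eq_iff forall_3) algebra
next
  case Euclidean
  have "U$3 = 1" "V$3 = 1" "x$3 = 1" "z$3 = 1" using assms(1-4) Euclidean by simp_all
  then show ?thesis using assms(5,6) unfolding w_def Euclidean
    by (simp add: coords3 vec_eq_iff forall_3) algebra
next
  case Hyperbolic
  have "lorentz d d = -1" if "d \<in> points g" for d using that Hyperbolic by simp
  then have "lorentz z U = lorentz x U" "lorentz z V = lorentz x V"
    using assms(1-6) Hyperbolic bilinear_tangent_form[of Hyperbolic] tangent_form_sym[of Hyperbolic]
    by simp_all
  then show ?thesis unfolding w_def Hyperbolic
    by (simp add: coords3 vec_eq_iff forall_3) algebra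
qed

lemma orthogonal_normal: "cross3 U V \<bullet> U = 0" "cross3 U V \<bullet> V = 0"
  by (simp_all add: coords3 algebra_simps)

lemma isometry_chord:
  assumes "f \<in> carrier (isometry_group g)" "x \<in> points g" "y \<in> points g"
  shows "tangent_form g (f x - f y) (f x - f y) = tangent_form g (x - y) (x - y)"
proof (rule chord_eq_if_geo_dist_eq)
  show "f x \<in> points g" "f y \<in> points g"
    using assms by (auto simp: isometry_group_def dest: Bij_imp_funcset)
  show "geo_dist g (f x) (f y) = geo_dist g x y"
    using assms by (simp add: isometry_group_def)
qed (use assms in auto)

text \<open>
  A reflection fixes a line and is only assumed to be an isometry other than the identity. As \<open>f x\<close>
  and \<open>x\<close> are equally far from \<open>U\<close> and \<open>V\<close>, the vector \<open>f x - x\<close> is a multiple of the normal, and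
  comparing chords with \<open>U\<close> leaves two possible multiples: \<open>f x\<close> is \<open>x\<close> or its mirror image. Some
  point \<open>x0\<close> is moved to its mirror image; a point off the line that was fixed would have the same
  distance from \<open>x0\<close> and from the mirror image of \<open>x0\<close>, which is impossible.
\<close>

lemma reflection_formula:
  assumes f: "is_reflection g L f" and UV: "U \<in> L" "V \<in> L" "U \<in> points g" "V \<in> points g"
    and w: "w = cross3 U V" "w \<noteq> 0" and x: "x \<in> points g"
  shows "f x = x - (2 * (w \<bullet> x) / (w \<bullet> raise g w)) *\<^sub>R raise g w"
proof -
  define N where "N = w \<bullet> raise g w"
  define r where "r = (\<lambda>x. x - (2 * (w \<bullet> x) / N) *\<^sub>R raise g w)"
  have wU: "w \<bullet> U = 0" using orthogonal_normal w by simp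
  have N: "N > 0" unfolding N_def using inner_raise_pos[OF UV(3) wU w(2)] .
  have fc: "f \<in> carrier (isometry_group g)" and nontriv: "f \<noteq> \<one>\<^bsub>isometry_group g\<^esub>"
    and fixed: "f U = U" "f V = V"
    using f UV by (auto simp: is_reflection_def)
  have chord: "tangent_form g (f x - f y) (f x - f y) = tangent_form g (x - y) (x - y)"
    if "x \<in> points g" "y \<in> points g" for x y
    using isometry_chord[OF fc that] .
  have fp: "f x \<in> points g" if "x \<in> points g" for x
    using fc that by (auto simp: isometry_group_def dest: Bij_imp_funcset)
  have along: "tangent_form g (x - l *\<^sub>R raise g w - y) (x - l *\<^sub>R raise g w - y) =
      tangent_form g (x - y) (x - y) + l * (l * N - 2 * (w \<bullet> (x - y)))"
    if "x \<in> points g" "y \<in> points g" for x y l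
  proof -
    have expand: "tangent_form g (d - l *\<^sub>R n) (d - l *\<^sub>R n) =
        tangent_form g d d + l * (l * tangent_form g n n - 2 * tangent_form g d n)" for d n
      by (simp add: bilinear_tangent_form tangent_form_sym[of g n d] algebra_simps)
    have swap: "x - l *\<^sub>R raise g w - y = (x - y) - l *\<^sub>R raise g w" by simp
    show ?thesis
      unfolding swap expand
      by (simp add: tangent_form_raise[OF that] tangent_form_raise_raise N_def)
  qed
  have dichotomy: "f x = x \<or> f x = r x" if x: "x \<in> points g" for x
  proof -
    define l where "l = - ((w \<bullet> (f x - x)) / N)"
    have "x - f x = l *\<^sub>R raise g w"
    proof -
      have "N *\<^sub>R (f x - x) = (w \<bullet> (f x - x)) *\<^sub>R raise g w"
        unfolding N_def w(1)
        by (rule chord_parallel_raise[OF UV(3,4) x fp[OF x]])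
           (use chord[OF x UV(3)] chord[OF x UV(4)] fixed in simp_all)
      then have "(1 / N) *\<^sub>R (N *\<^sub>R (f x - x)) = (1 / N) *\<^sub>R ((w \<bullet> (f x - x)) *\<^sub>R raise g w)"
        by (rule arg_cong)
      then have "f x - x = - l *\<^sub>R raise g w" using N by (simp add: l_def)
      then show ?thesis by (metis minus_diff_eq minus_minus scaleR_minus_left)
    qed
    then have fx: "f x = x - l *\<^sub>R raise g w" by (simp add: algebra_simps)
    have "l * (l * N - 2 * (w \<bullet> (x - U))) = 0"
      using along[OF x UV(3), of l] chord[OF x UV(3)] fx fixed by simp
    then have "l * (l * N - 2 * (w \<bullet> x)) = 0" by (simp add: inner_diff_right wU)
    then have "l = 0 \<or> l = 2 * (w \<bullet> x) / N" using N by (auto simp: field_simps)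
    then show ?thesis using fx by (auto simp: r_def)
  qed
  obtain x0 where x0: "x0 \<in> points g" "f x0 \<noteq> x0"
  proof (rule ccontr)
    assume "\<not> thesis"
    then have "\<forall>x\<in>points g. f x = x" using that by blast
    moreover have "f \<in> extensional (points g)"
      using fc by (auto simp: isometry_group_def dest: Bij_imp_extensional)
    ultimately have "f = (\<lambda>x\<in>points g. x)" by (auto simp: extensional_def restrict_def)
    then show False using nontriv by (simp add: isometry_group_def BijGroup_def)
  qed
  then have fx0: "f x0 = r x0" using dichotomy by blast
  then have wx0: "w \<bullet> x0 \<noteq> 0" using x0 by (auto simp: r_def)
  have "f x = r x"
  proof (rule ccontr)
    assume neq: "f x \<noteq> r x"
    then have fx: "f x = x" using dichotomy x by blast
    define l where "l = 2 * (w \<bullet> x0) / N"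
    have "l * (l * N - 2 * (w \<bullet> (x0 - x))) = 0"
      using along[OF x0(1) x, of l] chord[OF x0(1) x] fx fx0 by (simp add: r_def l_def)
    moreover have "l * N = 2 * (w \<bullet> x0)" "l \<noteq> 0" using N wx0 by (simp_all add: l_def)
    ultimately have "w \<bullet> x = 0" by (simp add: inner_diff_right)
    then show False using neq fx by (simp add: r_def)
  qed
  then show ?thesis by (simp add: r_def N_def)
qed

text \<open>
  Central projection from the origin brings the sum of the vertices, an interior point of the cone
  over the triangle, onto the model.
\<close>

lemma triangle_interior_point:
  assumes "nondegenerate_triangle g U V W"
  shows "\<exists>r>0. r *\<^sub>R (U + V + W) \<in> points g"
proof -
  let ?s = "U + V + W"
  have p: "U \<in> points g" "V \<in> points g" "W \<in> points g"
    using assms by (simp_all add: nondegenerate_triangle_def)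
  show ?thesis
  proof (cases g)
    case Spherical
    have "?s \<noteq> 0"
    proof
      assume "?s = 0"
      moreover have "det (vector [U, V, W] :: real^3^3) = det (vector [U, V, ?s] :: real^3^3)"
        by (simp add: det_3 algebra_simps)
      ultimately have "det (vector [U, V, W] :: real^3^3) = 0" by (simp add: det_3)
      then show False using assms by (simp add: nondegenerate_triangle_def orientation_def)
    qed
    then show ?thesis using Spherical by (intro exI[of _ "1 / norm ?s"]) simp
  next
    case Euclidean
    then show ?thesis using p by (intro exI[of _ "1/3"]) simp
  next
    case Hyperbolic
    have "lorentz ?s ?s = lorentz U U + lorentz V V + lorentz W W + 2 * lorentz U V + 2 * lorentz U W + 2 * lorentz V W"
      by (simp add: lorentz_def algebra_simps)
    then have neg: "- lorentz ?s ?s > 0"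
      using p Hyperbolic lorentz_ge_1[of U V] lorentz_ge_1[of U W] lorentz_ge_1[of V W] by simp
    have "lorentz (r *\<^sub>R ?s) (r *\<^sub>R ?s) = r\<^sup>2 * lorentz ?s ?s" for r
      by (simp add: lorentz_def power2_eq_square algebra_simps)
    then show ?thesis using p Hyperbolic neg
      by (intro exI[of _ "1 / sqrt (- lorentz ?s ?s)"]) (simp add: power_divide)
  qed
qed

section \<open>The group of isometries\<close>

lemma isometry_subgroup: 
  "subgroup (carrier (isometry_group g)) (BijGroup (points g))"
proof -
  interpret B: group "BijGroup (points g)" by (rule group_BijGroup)
  show ?thesis
  proof (rule B.subgroupI)
    show "carrier (isometry_group g) \<subseteq> carrier (BijGroup (points g))"
      by (auto simp: isometry_group_def BijGroup_def)
    have "(\<lambda>x\<in>points g. x) \<in> carrier (isometry_group g)"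
      by (simp add: isometry_group_def id_Bij)
    then show "carrier (isometry_group g) \<noteq> {}" by blast
  next
    fix f assume f: "f \<in> carrier (isometry_group g)"
    then have B: "f \<in> Bij (points g)" by (simp add: isometry_group_def)
    have f_inv: "f (inv_into (points g) f x) = x" if "x \<in> points g" for x
      using B that by (simp add: Bij_def bij_betw_def f_inv_into_f)
    have "geo_dist g (inv_into (points g) f x) (inv_into (points g) f y) = geo_dist g x y"
      if "x \<in> points g" "y \<in> points g" for x y
    proof -
      have "geo_dist g (f (inv_into (points g) f x)) (f (inv_into (points g) f y)) =
          geo_dist g (inv_into (points g) f x) (inv_into (points g) f y)"
        using f Bij_inv_into_mem[OF B] that by (simp add: isometry_group_def)
      then show ?thesis by (simp add: f_inv that)
    qed
    then show "inv\<^bsub>BijGroup (points g)\<^esub> f \<in> carrier (isometry_group g)"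
      using B by (simp add: inv_BijGroup isometry_group_def restrict_inv_into_Bij)
  next
    fix f h assume *: "f \<in> carrier (isometry_group g)" "h \<in> carrier (isometry_group g)"
    then have "compose (points g) f h \<in> Bij (points g)"
      by (intro compose_Bij) (simp_all add: isometry_group_def)
    with * show "f \<otimes>\<^bsub>BijGroup (points g)\<^esub> h \<in> carrier (isometry_group g)"
      using Bij_imp_funcset[of h "points g"]
      by (auto simp: isometry_group_def BijGroup_def compose_def Pi_iff)
  qed
qed

lemma group_isometry_group: "group (isometry_group g)"
proof -
  have "group (BijGroup (points g) \<lparr>carrier := carrier (isometry_group g)\<rparr>)"
    using subgroup.subgroup_is_group[OF isometry_subgroup group_BijGroup] .
  then show ?thesis by (simp add: isometry_group_def)
qed

lemma isometry_maps: "f \<in> carrier (isometry_group g) \<Longrightarrow> x \<in> points g \<Longrightarrow> f x \<in> points g"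
  by (auto simp: isometry_group_def dest: Bij_imp_funcset)

lemma isometry_mult:
  assumes "f \<in> carrier (isometry_group g)" "h \<in> carrier (isometry_group g)" "x \<in> points g"
  shows "(f \<otimes>\<^bsub>isometry_group g\<^esub> h) x = f (h x)"
  using assms by (simp add: isometry_group_def BijGroup_def compose_def)

lemma isometry_one: "x \<in> points g \<Longrightarrow> \<one>\<^bsub>isometry_group g\<^esub> x = x"
  by (simp add: isometry_group_def BijGroup_def)

lemma isometry_eqI:
  assumes "f \<in> carrier (isometry_group g)" "h \<in> carrier (isometry_group g)"
    and "\<And>x. x \<in> points g \<Longrightarrow> f x = h x"
  shows "f = h"
  using assms Bij_imp_extensional by (intro extensionalityI[of f "points g" h]) (auto simp: isometry_group_def)

lemma isometry_image_mult:
  assumes "f \<in> carrier (isometry_group g)" "h \<in> carrier (isometry_group g)" "Y \<subseteq> points g"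
  shows "(f \<otimes>\<^bsub>isometry_group g\<^esub> h) ` Y = f ` h ` Y"
  using isometry_mult[OF assms(1,2)] assms(3) by (force simp: image_iff)

text \<open>
  Inverses of generators are generators here, so \<open>generate\<close> consists of products of lists. The form
  of a right fold allows induction by multiplication from the left.
\<close>

lemma (in group) generate_involutions_words:
  assumes A: "A \<subseteq> carrier G" and inv: "\<And>s. s \<in> A \<Longrightarrow> s \<otimes> s = \<one>" and x: "x \<in> generate G A"
  shows "\<exists>ws. set ws \<subseteq> A \<and> x = foldr (\<otimes>) ws \<one>"
  using x
proof (induction rule: generate.induct)
  case one
  then show ?case by (intro exI[of _ "[]"]) simp
next
  case (incl h)
  then show ?case using A by (intro exI[of _ "[h]"]) auto
next
  case (inv h)
  then have "inv h = h" using A assms(2) inv_equality by blast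
  then show ?case using A inv by (intro exI[of _ "[h]"]) auto
next
  case (eng h1 h2)
  then obtain u v where uv: "set u \<subseteq> A" "h1 = foldr (\<otimes>) u \<one>" "set v \<subseteq> A" "h2 = foldr (\<otimes>) v \<one>"
    by blast
  have closed: "foldr (\<otimes>) u \<one> \<in> carrier G" if "set u \<subseteq> A" for u
    using that by (induction u) (use A in auto)
  have "foldr (\<otimes>) (u @ v) \<one> = foldr (\<otimes>) u \<one> \<otimes> foldr (\<otimes>) v \<one>"
    using uv(1) closed[OF uv(3)]
  proof (induction u)
    case (Cons s u)
    then show ?case using A closed[of u] by (auto simp: m_assoc)
  qed simp
  then show ?case using uv by (intro exI[of _ "u @ v"]) simp
qed

section \<open>Colours of the left cosets\<close>

lemma coset_enumeration_unique:
  assumes "group \<Gamma>" "subgroup S \<Gamma>" "coset_enumeration \<Gamma> S k cs" "f \<in> carrier \<Gamma>"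
  shows "\<exists>!i. i \<in> {1..k} \<and> f \<in> cs i"
proof -
  interpret group \<Gamma> by fact
  have bij: "bij_betw cs {1..k} (lcosets\<^bsub>\<Gamma>\<^esub> S)" using assms(3) by (simp add: coset_enumeration_def)
  have "f <#\<^bsub>\<Gamma>\<^esub> S \<in> lcosets\<^bsub>\<Gamma>\<^esub> S" using assms(4) by (auto simp: LCOSETS_def)
  then obtain i where i: "i \<in> {1..k}" "cs i = f <#\<^bsub>\<Gamma>\<^esub> S" using bij by (metis bij_betw_iff_bijections)
  have "j = i" if "j \<in> {1..k}" "f \<in> cs j" for j
  proof -
    have "cs j \<in> lcosets\<^bsub>\<Gamma>\<^esub> S" "cs i \<in> lcosets\<^bsub>\<Gamma>\<^esub> S" using bij_betwE[OF bij] that(1) i(1) by simp_all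
    moreover have "f \<in> cs i" using lcos_self[OF assms(4,2)] i by simp
    ultimately have "cs j = cs i" using lcos_disjoint[OF assms(2), of "cs j" "cs i"] that(2) by auto
    then show ?thesis by (rule inj_onD[OF bij_betw_imp_inj_on[OF bij] _ that(1) i(1)])
  qed
  moreover have "f \<in> cs i" using lcos_self[OF assms(4,2)] i by simp
  ultimately show ?thesis using i(1) by blast
qed

lemma piece_colour:
  assumes "group \<Gamma>" "subgroup S \<Gamma>" "coset_enumeration \<Gamma> S k cs" "f \<in> carrier \<Gamma>"
  shows "piece_colour k cs f \<in> {1..k}" "f \<in> cs (piece_colour k cs f)"
  using theI'[OF coset_enumeration_unique[OF assms]] unfolding piece_colour_def by blast+

lemma piece_colour_eqI:
  assumes "group \<Gamma>" "subgroup S \<Gamma>" "coset_enumeration \<Gamma> S k cs" "f \<in> carrier \<Gamma>"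
    and "i \<in> {1..k}" "f \<in> cs i"
  shows "piece_colour k cs f = i"
  unfolding piece_colour_def
  using coset_enumeration_unique[OF assms(1-4)] assms(5,6) by (intro the1_equality) auto

lemma coset_eq:
  assumes "group \<Gamma>" "subgroup S \<Gamma>" "coset_enumeration \<Gamma> S k cs"
    and "i \<in> {1..k}" "f \<in> cs i"
  shows "cs i = f <#\<^bsub>\<Gamma>\<^esub> S" "f \<in> carrier \<Gamma>"
proof -
  interpret group \<Gamma> by fact
  have "cs i \<in> lcosets\<^bsub>\<Gamma>\<^esub> S"
    using assms(3,4) by (auto simp: coset_enumeration_def dest: bij_betwE)
  then obtain e where e: "e \<in> carrier \<Gamma>" "cs i = e <#\<^bsub>\<Gamma>\<^esub> S" by (auto simp: LCOSETS_def)
  then show "cs i = f <#\<^bsub>\<Gamma>\<^esub> S" using l_repr_independence[of f e S] assms(2,5) by simp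
  show "f \<in> carrier \<Gamma>" using e assms(5) subgroup.elemlcos_carrier[OF assms(2,1)] by simp
qed

lemma piece_colour_eq_iff:
  assumes "group \<Gamma>" "subgroup S \<Gamma>" "coset_enumeration \<Gamma> S k cs"
    and f: "f \<in> carrier \<Gamma>" and h: "h \<in> carrier \<Gamma>"
  shows "piece_colour k cs f = piece_colour k cs h \<longleftrightarrow> inv\<^bsub>\<Gamma>\<^esub> f \<otimes>\<^bsub>\<Gamma>\<^esub> h \<in> S"
proof -
  interpret group \<Gamma> by fact
  let ?i = "piece_colour k cs f"
  have i: "?i \<in> {1..k}" "cs ?i = f <#\<^bsub>\<Gamma>\<^esub> S"
    using piece_colour[OF assms(1-4)] coset_eq(1)[OF assms(1-3)] by blast+
  have "?i = piece_colour k cs h \<longleftrightarrow> h \<in> cs ?i"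
    using piece_colour[OF assms(1-3) h] piece_colour_eqI[OF assms(1-3) h i(1)] by metis
  also have "\<dots> \<longleftrightarrow> inv\<^bsub>\<Gamma>\<^esub> f \<otimes>\<^bsub>\<Gamma>\<^esub> h \<in> S"
    unfolding i(2)
    by (rule iffI[OF subgroup.lcos_module_imp[OF assms(2,1) f] subgroup.lcos_module_rev[OF assms(2,1) f h]])
  finally show ?thesis .
qed

lemma piece_colour_surj:
  assumes "group \<Gamma>" "subgroup S \<Gamma>" "coset_enumeration \<Gamma> S k cs" and i: "i \<in> {1..k}"
  shows "\<exists>f\<in>carrier \<Gamma>. piece_colour k cs f = i"
proof -
  interpret group \<Gamma> by fact
  have "cs i \<in> lcosets\<^bsub>\<Gamma>\<^esub> S"
    using assms(3) i by (auto simp: coset_enumeration_def dest: bij_betwE)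
  then obtain e where e: "e \<in> carrier \<Gamma>" "cs i = e <#\<^bsub>\<Gamma>\<^esub> S" by (auto simp: LCOSETS_def)
  then show ?thesis using piece_colour_eqI[OF assms(1-3) e(1) i] lcos_self[OF e(1) assms(2)] by auto
qed

text \<open>
  The permutation is the one that left multiplication by \<open>h\<close> induces on the left cosets, transported
  to their indices by a choice of representatives.
\<close>

lemma coset_translation_permutes:
  assumes "group \<Gamma>" "subgroup S \<Gamma>" "coset_enumeration \<Gamma> S k cs" and h: "h \<in> carrier \<Gamma>"
  shows "\<exists>\<pi>. \<pi> permutes {1..k} \<and>
    (\<forall>f\<in>carrier \<Gamma>. piece_colour k cs (h \<otimes>\<^bsub>\<Gamma>\<^esub> f) = \<pi> (piece_colour k cs f))"
proof -
  interpret group \<Gamma> by fact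
  let ?pc = "piece_colour k cs"
  have invariant: "?pc (h \<otimes>\<^bsub>\<Gamma>\<^esub> f) = ?pc (h \<otimes>\<^bsub>\<Gamma>\<^esub> f') \<longleftrightarrow> ?pc f = ?pc f'"
    if "f \<in> carrier \<Gamma>" "f' \<in> carrier \<Gamma>" for f f'
  proof -
    have cancel: "inv\<^bsub>\<Gamma>\<^esub> h \<otimes>\<^bsub>\<Gamma>\<^esub> (h \<otimes>\<^bsub>\<Gamma>\<^esub> f') = f'"
      using h that by (metis inv_closed l_inv l_one m_assoc)
    have "inv\<^bsub>\<Gamma>\<^esub> (h \<otimes>\<^bsub>\<Gamma>\<^esub> f) \<otimes>\<^bsub>\<Gamma>\<^esub> (h \<otimes>\<^bsub>\<Gamma>\<^esub> f') = inv\<^bsub>\<Gamma>\<^esub> f \<otimes>\<^bsub>\<Gamma>\<^esub> f'"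
      using h that cancel by (simp add: inv_mult_group m_assoc)
    then show ?thesis using h that by (simp add: piece_colour_eq_iff[OF assms(1-3)])
  qed
  have "\<exists>f. f \<in> carrier \<Gamma> \<and> ?pc f = i" if "i \<in> {1..k}" for i
    using piece_colour_surj[OF assms(1-3) that] by blast
  then obtain rep where rep: "\<And>i. i \<in> {1..k} \<Longrightarrow> rep i \<in> carrier \<Gamma> \<and> ?pc (rep i) = i" by metis
  define \<pi> where "\<pi> = (\<lambda>i. if i \<in> {1..k} then ?pc (h \<otimes>\<^bsub>\<Gamma>\<^esub> rep i) else i)"
  have "inj_on \<pi> {1..k}"
    using rep invariant by (intro inj_onI) (metis \<pi>_def)
  moreover have "\<pi> ` {1..k} \<subseteq> {1..k}"
    using rep h piece_colour(1)[OF assms(1-3)] by (auto simp: \<pi>_def)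
  ultimately have "bij_betw \<pi> {1..k} {1..k}"
    by (simp add: bij_betw_def endo_inj_surj)
  then have "\<pi> permutes {1..k}" by (rule bij_imp_permutes) (auto simp: \<pi>_def)
  moreover have "?pc (h \<otimes>\<^bsub>\<Gamma>\<^esub> f) = \<pi> (?pc f)" if f: "f \<in> carrier \<Gamma>" for f
  proof -
    have "?pc f \<in> {1..k}" using piece_colour(1)[OF assms(1-3) f] .
    then show ?thesis using rep invariant[OF f, of "rep (?pc f)"] by (simp add: \<pi>_def)
  qed
  ultimately show ?thesis by blast
qed

section \<open>Groups generated by three reflections with a free base point\<close>

text \<open>
  The point \<open>x0\<close> stands for an interior point of the chamber \<open>F\<close>. That only the identity moves \<open>x0\<close>
  into \<open>F\<close> is the single property of the fundamental domain from which the colouring theorem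
  follows.
\<close>

locale kaleidoscope =
  fixes g :: geometry and a b c :: isom and F :: "(real^3) set" and x0 :: "real^3"
  assumes mirror_isometry: "s \<in> {a, b, c} \<Longrightarrow> s \<in> carrier (isometry_group g)"
    and mirror_involution: "s \<in> {a, b, c} \<Longrightarrow> s \<otimes>\<^bsub>isometry_group g\<^esub> s = \<one>\<^bsub>isometry_group g\<^esub>"
    and mirror_reverses: "\<lbrakk>s \<in> {a, b, c}; x \<in> points g; y \<in> points g; z \<in> points g\<rbrakk>
      \<Longrightarrow> orientation (s x) (s y) (s z) = - orientation x y z"
    and nonzero_orientation: "\<exists>x\<in>points g. \<exists>y\<in>points g. \<exists>z\<in>points g. orientation x y z \<noteq> 0"
    and chamber_points: "F \<subseteq> points g"
    and base_point: "x0 \<in> F"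
    and base_point_free: "\<lbrakk>u \<in> generate (isometry_group g) {a, b, c}; u x0 \<in> F\<rbrakk>
      \<Longrightarrow> u = \<one>\<^bsub>isometry_group g\<^esub>"
begin

abbreviation "M \<equiv> isometry_group g"
abbreviation "G \<equiv> generate M {a, b, c}"
abbreviation "\<Gamma> \<equiv> rotation_group g a b c"

sublocale M: group M by (rule group_isometry_group)

lemma mirrors_carrier: "{a, b, c} \<subseteq> carrier M"
  using mirror_isometry by blast

lemma subgroup_G: "subgroup G M"
  by (rule M.generate_is_subgroup[OF mirrors_carrier])

lemmas G_carrier = subgroup.mem_carrier[OF subgroup_G]
lemmas G_mult = subgroup.m_closed[OF subgroup_G]
lemmas G_inv = subgroup.m_inv_closed[OF subgroup_G]

lemma mirror_in_G: "s \<in> {a, b, c} \<Longrightarrow> s \<in> G"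
  by (rule generate.incl)

lemma inverse_apply: "f \<in> carrier M \<Longrightarrow> x \<in> points g \<Longrightarrow> (inv\<^bsub>M\<^esub> f) (f x) = x"
  using isometry_mult[of "inv\<^bsub>M\<^esub> f" g f x] by (simp add: isometry_one)

lemma apply_inverse: "f \<in> carrier M \<Longrightarrow> x \<in> points g \<Longrightarrow> f ((inv\<^bsub>M\<^esub> f) x) = x"
  using isometry_mult[of f g "inv\<^bsub>M\<^esub> f" x] by (simp add: isometry_one)

definition orientation_reversing :: "isom \<Rightarrow> bool" where
  "orientation_reversing f \<longleftrightarrow> (\<forall>x\<in>points g. \<forall>y\<in>points g. \<forall>z\<in>points g.
     orientation (f x) (f y) (f z) = - orientation x y z)"

lemma not_preserving_and_reversing: "orientation_reversing f \<Longrightarrow> \<not> orientation_preserving g f"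
  using nonzero_orientation unfolding orientation_reversing_def orientation_preserving_def
  by fastforce

lemma preserving_or_reversing:
  assumes "f \<in> G" shows "orientation_preserving g f \<or> orientation_reversing f"
proof -
  obtain ws where ws: "set ws \<subseteq> {a, b, c}" "f = foldr (\<otimes>\<^bsub>M\<^esub>) ws \<one>\<^bsub>M\<^esub>"
    using M.generate_involutions_words[OF mirrors_carrier mirror_involution assms] by blast
  have "foldr (\<otimes>\<^bsub>M\<^esub>) ws \<one>\<^bsub>M\<^esub> \<in> carrier M \<and>
    (orientation_preserving g (foldr (\<otimes>\<^bsub>M\<^esub>) ws \<one>\<^bsub>M\<^esub>) \<or>
     orientation_reversing (foldr (\<otimes>\<^bsub>M\<^esub>) ws \<one>\<^bsub>M\<^esub>))"
    using ws(1)
  proof (induction ws)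
    case Nil
    then show ?case by (simp add: orientation_preserving_def isometry_one)
  next
    case (Cons s ws)
    define h where "h = foldr (\<otimes>\<^bsub>M\<^esub>) ws \<one>\<^bsub>M\<^esub>"
    have s: "s \<in> {a, b, c}" and h: "h \<in> carrier M" "orientation_preserving g h \<or> orientation_reversing h"
      using Cons by (auto simp: h_def)
    have "orientation ((s \<otimes>\<^bsub>M\<^esub> h) x) ((s \<otimes>\<^bsub>M\<^esub> h) y) ((s \<otimes>\<^bsub>M\<^esub> h) z) = - orientation (h x) (h y) (h z)"
      if "x \<in> points g" "y \<in> points g" "z \<in> points g" for x y z
      using that mirror_reverses[OF s] h(1)
      by (simp add: isometry_mult[OF mirror_isometry[OF s]] isometry_maps)
    then have "orientation_preserving g (s \<otimes>\<^bsub>M\<^esub> h) \<or> orientation_reversing (s \<otimes>\<^bsub>M\<^esub> h)"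
      using h(2) by (auto simp: orientation_preserving_def orientation_reversing_def)
    then show ?case using mirror_isometry[OF s] h(1) by (simp add: h_def)
  qed
  then show ?thesis by (simp add: ws(2))
qed

lemma carrier_rotation_group: "carrier \<Gamma> = {f \<in> G. orientation_preserving g f}"
  by (simp add: rotation_group_def reflection_group_def)

lemma rotation_group_mult: "f \<otimes>\<^bsub>\<Gamma>\<^esub> h = f \<otimes>\<^bsub>M\<^esub> h"
  by (simp add: rotation_group_def)

lemma subgroup_rotation_group: "subgroup (carrier \<Gamma>) M"
proof (rule M.subgroupI)
  show "carrier \<Gamma> \<subseteq> carrier M" using G_carrier by (auto simp: carrier_rotation_group)
  show "carrier \<Gamma> \<noteq> {}"
    using generate.one[of M "{a, b, c}"] by (auto simp: carrier_rotation_group orientation_preserving_def isometry_one)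
next
  fix f assume f: "f \<in> carrier \<Gamma>"
  then have fG: "f \<in> G" and fM: "f \<in> carrier M" and op: "orientation_preserving g f"
    using G_carrier by (auto simp: carrier_rotation_group)
  have im: "(inv\<^bsub>M\<^esub> f) x \<in> points g" if "x \<in> points g" for x
    using isometry_maps[OF M.inv_closed[OF fM]] that .
  have "orientation ((inv\<^bsub>M\<^esub> f) x) ((inv\<^bsub>M\<^esub> f) y) ((inv\<^bsub>M\<^esub> f) z) = orientation x y z"
    if "x \<in> points g" "y \<in> points g" "z \<in> points g" for x y z
  proof -
    have "orientation (f ((inv\<^bsub>M\<^esub> f) x)) (f ((inv\<^bsub>M\<^esub> f) y)) (f ((inv\<^bsub>M\<^esub> f) z))
        = orientation ((inv\<^bsub>M\<^esub> f) x) ((inv\<^bsub>M\<^esub> f) y) ((inv\<^bsub>M\<^esub> f) z)"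
      using op im that unfolding orientation_preserving_def by blast
    then show ?thesis by (simp add: apply_inverse[OF fM] that)
  qed
  then show "inv\<^bsub>M\<^esub> f \<in> carrier \<Gamma>"
    using G_inv[OF fG] by (simp add: carrier_rotation_group orientation_preserving_def)
next
  fix f h assume "f \<in> carrier \<Gamma>" "h \<in> carrier \<Gamma>"
  then show "f \<otimes>\<^bsub>M\<^esub> h \<in> carrier \<Gamma>"
    using G_carrier G_mult
    by (auto simp: carrier_rotation_group orientation_preserving_def isometry_mult isometry_maps)
qed

lemma group_rotation_group: "group \<Gamma>"
proof -
  have "group (M \<lparr>carrier := carrier \<Gamma>\<rparr>)"
    using subgroup.subgroup_is_group[OF subgroup_rotation_group M.is_group] .
  then show ?thesis by (simp add: rotation_group_def)
qed

lemma rotation_group_inv: "f \<in> carrier \<Gamma> \<Longrightarrow> inv\<^bsub>\<Gamma>\<^esub> f = inv\<^bsub>M\<^esub> f"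
  using M.m_inv_consistent[OF subgroup_rotation_group] by (simp add: rotation_group_def)

lemma rotation_in_G: "f \<in> carrier \<Gamma> \<Longrightarrow> f \<in> G"
  by (simp add: carrier_rotation_group)

lemma rotation_iff_not_reversing: "f \<in> G \<Longrightarrow> f \<in> carrier \<Gamma> \<longleftrightarrow> \<not> orientation_reversing f"
  using preserving_or_reversing not_preserving_and_reversing by (auto simp: carrier_rotation_group)

lemma mirror_mult_rotation_iff:
  assumes s: "s \<in> {a, b, c}" and f: "f \<in> G"
  shows "s \<otimes>\<^bsub>M\<^esub> f \<in> carrier \<Gamma> \<longleftrightarrow> f \<notin> carrier \<Gamma>"
proof -
  have "orientation ((s \<otimes>\<^bsub>M\<^esub> f) x) ((s \<otimes>\<^bsub>M\<^esub> f) y) ((s \<otimes>\<^bsub>M\<^esub> f) z) = - orientation (f x) (f y) (f z)"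
    if "x \<in> points g" "y \<in> points g" "z \<in> points g" for x y z
    using that mirror_reverses[OF s] G_carrier[OF f]
    by (simp add: isometry_mult[OF mirror_isometry[OF s]] isometry_maps)
  then have "orientation_reversing (s \<otimes>\<^bsub>M\<^esub> f) \<longleftrightarrow> orientation_preserving g f"
    by (simp add: orientation_reversing_def orientation_preserving_def)
  then show ?thesis
    using rotation_iff_not_reversing[OF G_mult[OF mirror_in_G[OF s] f]] f
    by (simp add: carrier_rotation_group)
qed

lemma mult_mirror_rotation_iff:
  assumes s: "s \<in> {a, b, c}" and f: "f \<in> G"
  shows "f \<otimes>\<^bsub>M\<^esub> s \<in> carrier \<Gamma> \<longleftrightarrow> f \<notin> carrier \<Gamma>"
proof -
  have "orientation ((f \<otimes>\<^bsub>M\<^esub> s) x) ((f \<otimes>\<^bsub>M\<^esub> s) y) ((f \<otimes>\<^bsub>M\<^esub> s) z) =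
      (if orientation_preserving g f then - orientation x y z else orientation x y z)"
    if "x \<in> points g" "y \<in> points g" "z \<in> points g" for x y z
    using that preserving_or_reversing[OF f] mirror_reverses[OF s]
    by (auto simp: isometry_mult[OF G_carrier[OF f] mirror_isometry[OF s]]
        isometry_maps[OF mirror_isometry[OF s]] orientation_preserving_def orientation_reversing_def)
  note or = this
  have "orientation_reversing (f \<otimes>\<^bsub>M\<^esub> s) \<longleftrightarrow> orientation_preserving g f"
  proof (cases "orientation_preserving g f")
    case True
    then show ?thesis using or by (simp add: orientation_reversing_def)
  next
    case False
    obtain x y z where xyz: "x \<in> points g" "y \<in> points g" "z \<in> points g" "orientation x y z \<noteq> 0"
      using nonzero_orientation by blast
    then have "orientation ((f \<otimes>\<^bsub>M\<^esub> s) x) ((f \<otimes>\<^bsub>M\<^esub> s) y) ((f \<otimes>\<^bsub>M\<^esub> s) z) \<noteq> - orientation x y z"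
      using or[OF xyz(1-3)] False by simp
    then have "\<not> orientation_reversing (f \<otimes>\<^bsub>M\<^esub> s)"
      unfolding orientation_reversing_def using xyz(1-3) by blast
    then show ?thesis using False by simp
  qed
  then show ?thesis
    using rotation_iff_not_reversing[OF G_mult[OF f mirror_in_G[OF s]]] f
    by (simp add: carrier_rotation_group)
qed

end

section \<open>Colourings of the tiles around a vertex\<close>

text \<open>
  The tile \<open>U\<close> is the union of the images of \<open>F\<close> under the dihedral group of the mirrors \<open>s\<close> and \<open>t\<close>,
  and the chamber pairs \<open>f D\<close> are the pieces that carry the colours.
\<close>

locale kaleidoscope_tile = kaleidoscope +
  fixes s t :: isom
  assumes s: "s \<in> {a, b, c}" and t: "t \<in> {a, b, c}"
begin

abbreviation "H \<equiv> generate M {s, t}"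
abbreviation "U \<equiv> \<Union>h\<in>H. h ` F"
abbreviation "D \<equiv> F \<union> s ` F"
abbreviation "T \<equiv> tiling g a b c F {s, t}"

lemma subgroup_H: "subgroup H M"
  using mirror_isometry s t by (intro M.generate_is_subgroup) auto

lemma H_subset_G: "H \<subseteq> G"
  using s t by (intro M.mono_generate) auto

lemma U_points: "U \<subseteq> points g"
  using chamber_points isometry_maps subgroup.mem_carrier[OF subgroup_H] by blast

lemma tiling_eq: "T = (\<lambda>f. f ` U) ` G"
  by (simp add: tiling_def reflection_group_def)

text \<open>
  If \<open>f D\<close> is contained in \<open>k U\<close>, then \<open>f x0\<close> lies in some \<open>k h F\<close> with \<open>h\<close> in \<open>H\<close>, so \<open>(k h)\<inverse> f\<close>
  moves \<open>x0\<close> into \<open>F\<close> and is the identity.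
\<close>

lemma piece_in_tile_iff:
  assumes f: "f \<in> G" and k: "k \<in> G"
  shows "f ` D \<subseteq> k ` U \<longleftrightarrow> inv\<^bsub>M\<^esub> k \<otimes>\<^bsub>M\<^esub> f \<in> H"
proof
  assume "f ` D \<subseteq> k ` U"
  then have "f x0 \<in> k ` U" using base_point by blast
  then obtain h y where h: "h \<in> H" and y: "y \<in> F" and eq: "f x0 = k (h y)" by blast
  have kh: "k \<otimes>\<^bsub>M\<^esub> h \<in> G" using k h H_subset_G G_mult by blast
  have x0: "x0 \<in> points g" "y \<in> points g" using base_point y chamber_points by auto
  let ?u = "inv\<^bsub>M\<^esub> (k \<otimes>\<^bsub>M\<^esub> h) \<otimes>\<^bsub>M\<^esub> f"
  have "f x0 = (k \<otimes>\<^bsub>M\<^esub> h) y"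
    using eq isometry_mult[OF G_carrier[OF k] _ x0(2)] h H_subset_G G_carrier by auto
  then have "?u x0 = y"
    using isometry_mult[OF M.inv_closed[OF G_carrier[OF kh]] G_carrier[OF f] x0(1)]
      inverse_apply[OF G_carrier[OF kh] x0(2)] by simp
  moreover have "?u \<in> G" using G_mult[OF G_inv[OF kh] f] .
  ultimately have "?u = \<one>\<^bsub>M\<^esub>" using base_point_free y by simp
  then have "f = k \<otimes>\<^bsub>M\<^esub> h"
    using G_carrier[OF f] G_carrier[OF kh] by (metis M.inv_closed M.inv_equality M.inv_inv)
  moreover have "h \<in> carrier M" using h subgroup.mem_carrier[OF subgroup_H] by blast
  ultimately show "inv\<^bsub>M\<^esub> k \<otimes>\<^bsub>M\<^esub> f \<in> H"
    using h G_carrier[OF k] by (simp add: M.m_assoc[symmetric])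
next
  assume h: "inv\<^bsub>M\<^esub> k \<otimes>\<^bsub>M\<^esub> f \<in> H"
  define h where "h = inv\<^bsub>M\<^esub> k \<otimes>\<^bsub>M\<^esub> f"
  have hH: "h \<in> H" and hs: "h \<otimes>\<^bsub>M\<^esub> s \<in> H"
    using h subgroup.m_closed[OF subgroup_H h generate.incl[of s]] by (auto simp: h_def)
  have cM: "h \<in> carrier M" "k \<in> carrier M" "s \<in> carrier M"
    using hH subgroup.mem_carrier[OF subgroup_H] G_carrier[OF k] mirror_isometry[OF s] by auto
  have fh: "f = k \<otimes>\<^bsub>M\<^esub> h"
    using cM G_carrier[OF f] by (simp add: h_def M.m_assoc[symmetric])
  have "f ` F = k ` h ` F" using isometry_image_mult[OF cM(2,1) chamber_points] fh by simp
  moreover have sF: "s ` F \<subseteq> points g" using isometry_maps[OF cM(3)] chamber_points by blast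
  have "f ` s ` F = k ` (h \<otimes>\<^bsub>M\<^esub> s) ` F"
    using isometry_image_mult[OF cM(2,1) sF] isometry_image_mult[OF cM(1,3) chamber_points] fh by simp
  ultimately show "f ` D \<subseteq> k ` U" using hH hs by (simp add: image_Un) blast
qed

text \<open>
  Modulo \<open>S\<close> every word in \<open>s\<close> and \<open>t\<close> is trivial or equal to \<open>s\<close>, according to the parity of its
  length, and orientation excludes the second case. This is expressed without cosets: \<open>f\<close> or \<open>s f\<close>
  belongs to \<open>S\<close>.
\<close>

lemma even_words_in_subgroup:
  assumes S: "subgroup S \<Gamma>" and st: "s \<otimes>\<^bsub>M\<^esub> t \<in> S" and f: "f \<in> H" "f \<in> carrier \<Gamma>"
  shows "f \<in> S"
proof -
  have SG: "S \<subseteq> carrier \<Gamma>" using subgroup.subset[OF S] .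
  have mult: "e \<otimes>\<^bsub>M\<^esub> e' \<in> S" if "e \<in> S" "e' \<in> S" for e e'
    using subgroup.m_closed[OF S that] by (simp add: rotation_group_mult)
  have sc: "s \<in> carrier M" "t \<in> carrier M" using mirror_isometry s t by auto
  have ss: "s \<otimes>\<^bsub>M\<^esub> s = \<one>\<^bsub>M\<^esub>" "t \<otimes>\<^bsub>M\<^esub> t = \<one>\<^bsub>M\<^esub>" using mirror_involution s t by auto
  have ts: "t \<otimes>\<^bsub>M\<^esub> s \<in> S"
  proof -
    have "inv\<^bsub>M\<^esub> (s \<otimes>\<^bsub>M\<^esub> t) = t \<otimes>\<^bsub>M\<^esub> s"
      using sc ss by (simp add: M.inv_mult_group M.inv_equality)
    then show ?thesis
      using subgroup.m_inv_closed[OF S st] rotation_group_inv st SG by auto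
  qed
  have cancel: "u \<otimes>\<^bsub>M\<^esub> (u \<otimes>\<^bsub>M\<^esub> e) = e"
    if "u \<in> {s, t}" "e \<in> carrier M" for u e
    using that sc ss by (auto simp: M.m_assoc[symmetric])
  obtain ws where ws: "set ws \<subseteq> {s, t}" "f = foldr (\<otimes>\<^bsub>M\<^esub>) ws \<one>\<^bsub>M\<^esub>"
    using M.generate_involutions_words[OF _ _ f(1)] sc ss by auto
  have "foldr (\<otimes>\<^bsub>M\<^esub>) ws \<one>\<^bsub>M\<^esub> \<in> carrier M \<and>
     (foldr (\<otimes>\<^bsub>M\<^esub>) ws \<one>\<^bsub>M\<^esub> \<in> S \<or> s \<otimes>\<^bsub>M\<^esub> foldr (\<otimes>\<^bsub>M\<^esub>) ws \<one>\<^bsub>M\<^esub> \<in> S)"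
    using ws(1)
  proof (induction ws)
    case Nil
    then show ?case using subgroup.one_closed[OF S] by (simp add: rotation_group_def)
  next
    case (Cons u ws)
    define e where "e = foldr (\<otimes>\<^bsub>M\<^esub>) ws \<one>\<^bsub>M\<^esub>"
    have e: "e \<in> carrier M" "e \<in> S \<or> s \<otimes>\<^bsub>M\<^esub> e \<in> S" and u: "u = s \<or> u = t"
      using Cons by (auto simp: e_def)
    have "u \<otimes>\<^bsub>M\<^esub> e \<in> S \<or> s \<otimes>\<^bsub>M\<^esub> (u \<otimes>\<^bsub>M\<^esub> e) \<in> S"
      using e(2)
    proof
      assume eS: "e \<in> S"
      have "s \<otimes>\<^bsub>M\<^esub> (t \<otimes>\<^bsub>M\<^esub> e) = (s \<otimes>\<^bsub>M\<^esub> t) \<otimes>\<^bsub>M\<^esub> e"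
        using sc e(1) by (simp add: M.m_assoc)
      then have "s \<otimes>\<^bsub>M\<^esub> (t \<otimes>\<^bsub>M\<^esub> e) \<in> S" using mult[OF st eS] by (simp only:)
      moreover have "s \<otimes>\<^bsub>M\<^esub> (s \<otimes>\<^bsub>M\<^esub> e) \<in> S" using cancel[of s e] e(1) eS by simp
      ultimately show ?thesis using u by blast
    next
      assume se: "s \<otimes>\<^bsub>M\<^esub> e \<in> S"
      have "t \<otimes>\<^bsub>M\<^esub> e = (t \<otimes>\<^bsub>M\<^esub> s) \<otimes>\<^bsub>M\<^esub> (s \<otimes>\<^bsub>M\<^esub> e)"
        using sc e(1) cancel[of s e] by (simp add: M.m_assoc)
      then have "t \<otimes>\<^bsub>M\<^esub> e \<in> S" using mult[OF ts se] by (simp only:)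
      then show ?thesis using u se by blast
    qed
    then show ?case using e(1) u sc by (auto simp: e_def)
  qed
  then have "f \<in> S \<or> s \<otimes>\<^bsub>M\<^esub> f \<in> S" by (simp add: ws(2))
  then show ?thesis
    using mirror_mult_rotation_iff[OF s rotation_in_G[OF f(2)]] f(2) SG by blast
qed

text \<open>
  The tile \<open>k U\<close> is also \<open>k s U\<close>, and one of \<open>k\<close>, \<open>k s\<close> is a rotation.
\<close>

lemma tile_contains_piece:
  assumes "x \<in> T" shows "\<exists>f\<in>carrier \<Gamma>. f ` D \<subseteq> x"
proof -
  obtain k where k: "k \<in> G" "x = k ` U" using assms unfolding tiling_eq by blast
  have "inv\<^bsub>M\<^esub> k \<otimes>\<^bsub>M\<^esub> k \<in> H" "inv\<^bsub>M\<^esub> k \<otimes>\<^bsub>M\<^esub> (k \<otimes>\<^bsub>M\<^esub> s) \<in> H"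
    using G_carrier[OF k(1)] mirror_isometry[OF s] generate.one[of M "{s, t}"] generate.incl[of s "{s, t}" M]
    by (simp_all add: M.m_assoc[symmetric])
  then have "k ` D \<subseteq> x" "(k \<otimes>\<^bsub>M\<^esub> s) ` D \<subseteq> x"
    using piece_in_tile_iff[OF _ k(1)] k G_mult[OF k(1) mirror_in_G[OF s]] by auto
  then show ?thesis using mult_mirror_rotation_iff[OF s k(1)] by blast
qed

text \<open>
  In one direction compare the pieces \<open>D\<close> and \<open>s t D\<close> of the tile \<open>U\<close>. In the other direction, two
  rotations whose pieces lie in one tile differ by an orientation-preserving element of \<open>H\<close>.
\<close>

lemma piece_colours_agree_iff:
  assumes S: "subgroup S \<Gamma>" and cs: "coset_enumeration \<Gamma> S k cs"
  shows "(\<forall>x\<in>T. \<forall>f\<in>carrier \<Gamma>. \<forall>f'\<in>carrier \<Gamma>. f ` D \<subseteq> x \<and> f' ` D \<subseteq> x \<longrightarrow>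
      piece_colour k cs f = piece_colour k cs f') \<longleftrightarrow> s \<otimes>\<^bsub>M\<^esub> t \<in> S"
    (is "?agree \<longleftrightarrow> _")
proof
  assume agree: ?agree
  have one: "\<one>\<^bsub>M\<^esub> \<in> G" "\<one>\<^bsub>M\<^esub> \<in> carrier \<Gamma>"
    using subgroup.one_closed[OF subgroup_G] subgroup.one_closed[OF subgroup_rotation_group] by auto
  have stH: "s \<otimes>\<^bsub>M\<^esub> t \<in> H" by (intro generate.eng generate.incl) auto
  have st: "s \<otimes>\<^bsub>M\<^esub> t \<in> carrier \<Gamma>"
    using mirror_mult_rotation_iff[OF s mirror_in_G[OF t]]
      mult_mirror_rotation_iff[OF t one(1)] one(2) mirror_isometry[OF t] by simp
  have "\<one>\<^bsub>M\<^esub> ` D \<subseteq> \<one>\<^bsub>M\<^esub> ` U"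
    by (rule iffD2[OF piece_in_tile_iff[OF one(1) one(1)]]) (simp add: generate.one)
  moreover have "(s \<otimes>\<^bsub>M\<^esub> t) ` D \<subseteq> \<one>\<^bsub>M\<^esub> ` U"
    by (rule iffD2[OF piece_in_tile_iff[OF rotation_in_G[OF st] one(1)]])
       (use stH subgroup.mem_carrier[OF subgroup_H stH] in simp)
  moreover have "\<one>\<^bsub>M\<^esub> ` U \<in> T" unfolding tiling_eq using one(1) by (rule imageI)
  ultimately have "piece_colour k cs \<one>\<^bsub>M\<^esub> = piece_colour k cs (s \<otimes>\<^bsub>M\<^esub> t)"
    using agree[rule_format, OF _ one(2) st] by simp
  then show "s \<otimes>\<^bsub>M\<^esub> t \<in> S"
    using piece_colour_eq_iff[OF group_rotation_group S cs one(2) st]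
      rotation_group_inv[OF one(2)] subgroup.mem_carrier[OF subgroup_H stH] by (simp add: rotation_group_mult)
next
  assume st: "s \<otimes>\<^bsub>M\<^esub> t \<in> S"
  show ?agree
  proof (intro ballI impI)
    fix x f f' assume x: "x \<in> T" and f: "f \<in> carrier \<Gamma>" and f': "f' \<in> carrier \<Gamma>"
      and sub: "f ` D \<subseteq> x \<and> f' ` D \<subseteq> x"
    obtain e where k: "e \<in> G" "x = e ` U" using x unfolding tiling_eq by blast
    note cM = G_carrier[OF k(1)] G_carrier[OF rotation_in_G[OF f]] G_carrier[OF rotation_in_G[OF f']]
    have "inv\<^bsub>M\<^esub> e \<otimes>\<^bsub>M\<^esub> h \<in> H" if "h \<in> carrier \<Gamma>" "h ` D \<subseteq> x" for h
      by (rule iffD1[OF piece_in_tile_iff[OF rotation_in_G[OF that(1)] k(1)]]) (use that(2) k(2) in simp)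
    then have "inv\<^bsub>M\<^esub> e \<otimes>\<^bsub>M\<^esub> f \<in> H" "inv\<^bsub>M\<^esub> e \<otimes>\<^bsub>M\<^esub> f' \<in> H"
      using f f' sub by blast+
    then have "inv\<^bsub>M\<^esub> (inv\<^bsub>M\<^esub> e \<otimes>\<^bsub>M\<^esub> f) \<otimes>\<^bsub>M\<^esub> (inv\<^bsub>M\<^esub> e \<otimes>\<^bsub>M\<^esub> f') \<in> H"
      using subgroup.m_closed[OF subgroup_H] subgroup.m_inv_closed[OF subgroup_H] by blast
    moreover have "e \<otimes>\<^bsub>M\<^esub> (inv\<^bsub>M\<^esub> e \<otimes>\<^bsub>M\<^esub> f') = f'"
      using cM by (simp add: M.m_assoc[symmetric])
    then have "inv\<^bsub>M\<^esub> (inv\<^bsub>M\<^esub> e \<otimes>\<^bsub>M\<^esub> f) \<otimes>\<^bsub>M\<^esub> (inv\<^bsub>M\<^esub> e \<otimes>\<^bsub>M\<^esub> f') = inv\<^bsub>M\<^esub> f \<otimes>\<^bsub>M\<^esub> f'"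
      using cM by (simp add: M.inv_mult_group M.m_assoc)
    ultimately have "inv\<^bsub>M\<^esub> f \<otimes>\<^bsub>M\<^esub> f' \<in> H" by simp
    moreover have "inv\<^bsub>M\<^esub> f \<otimes>\<^bsub>M\<^esub> f' \<in> carrier \<Gamma>"
      using subgroup.m_closed[OF subgroup_rotation_group subgroup.m_inv_closed[OF subgroup_rotation_group f] f'] .
    ultimately have "inv\<^bsub>M\<^esub> f \<otimes>\<^bsub>M\<^esub> f' \<in> S" using even_words_in_subgroup[OF S st] by blast
    then show "piece_colour k cs f = piece_colour k cs f'"
      using piece_colour_eq_iff[OF group_rotation_group S cs f f'] rotation_group_inv[OF f]
      by (simp add: rotation_group_mult)
  qed
qed

text \<open>
  Once the colours of the pieces agree on tiles, perfectness is automatic: tiles inherit the colours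
  of their pieces, every coset occurs, and \<open>coset_translation_permutes\<close> gives the permutations.
\<close>

theorem induces_perfect_colouring_iff:
  assumes S: "subgroup S \<Gamma>" and cs: "coset_enumeration \<Gamma> S k cs"
  shows "induces_perfect_colouring \<Gamma> D k cs T \<longleftrightarrow> s \<otimes>\<^bsub>\<Gamma>\<^esub> t \<in> S"
proof -
  define agree where "agree \<longleftrightarrow> (\<forall>x\<in>T. \<forall>f\<in>carrier \<Gamma>. \<forall>f'\<in>carrier \<Gamma>.
      f ` D \<subseteq> x \<and> f' ` D \<subseteq> x \<longrightarrow> piece_colour k cs f = piece_colour k cs f')"
  let ?col = "induced_colour \<Gamma> D k cs"
  have "perfect_colouring \<Gamma> k T ?col" if agree: agree
  proof -
    have col: "?col x = piece_colour k cs f" if xf: "x \<in> T" "f \<in> carrier \<Gamma>" "f ` D \<subseteq> x" for x f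
      unfolding induced_colour_def
    proof (rule the_equality)
      show "\<exists>f'\<in>carrier \<Gamma>. f' ` D \<subseteq> x \<and> piece_colour k cs f' = piece_colour k cs f"
        using xf(2,3) by (intro bexI[of _ f] conjI refl)
      fix i assume "\<exists>f'\<in>carrier \<Gamma>. f' ` D \<subseteq> x \<and> piece_colour k cs f' = i"
      then obtain f' where f': "f' \<in> carrier \<Gamma>" "f' ` D \<subseteq> x" "piece_colour k cs f' = i" by (elim bexE conjE)
      show "i = piece_colour k cs f"
        using agree[unfolded agree_def, rule_format, OF xf(1) f'(1) xf(2) conjI[OF f'(2) xf(3)]] f'(3) by (simp only:)
    qed
    have "colouring k T ?col"
      unfolding colouring_def
    proof (intro equalityI subsetI)
      fix i assume "i \<in> ?col ` T"
      then obtain x where x: "x \<in> T" "i = ?col x" by blast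
      obtain f where f: "f \<in> carrier \<Gamma>" "f ` D \<subseteq> x" using tile_contains_piece[OF x(1)] by blast
      show "i \<in> {1..k}"
        using col[OF x(1) f] x(2) piece_colour(1)[OF group_rotation_group S cs f(1)] by simp
    next
      fix i assume "i \<in> {1..k}"
      then obtain f where f: "f \<in> carrier \<Gamma>" "piece_colour k cs f = i"
        using piece_colour_surj[OF group_rotation_group S cs] by blast
      have fG: "f \<in> G" using rotation_in_G[OF f(1)] .
      have "f ` D \<subseteq> f ` U"
        using piece_in_tile_iff[OF fG fG] G_carrier[OF fG] generate.one[of M "{s, t}"] by simp
      moreover have fU: "f ` U \<in> T" unfolding tiling_eq using fG by (rule imageI)
      ultimately have "i = ?col (f ` U)" using col[OF fU f(1)] f(2) by simp
      then show "i \<in> ?col ` T" using fU by (rule image_eqI)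
    qed
    moreover have "\<exists>\<pi>. \<pi> permutes {1..k} \<and> (\<forall>x\<in>T. ?col (h ` x) = \<pi> (?col x))"
      if h: "h \<in> carrier \<Gamma>" for h
    proof -
      obtain \<pi> where \<pi>: "\<pi> permutes {1..k}"
        "\<And>f. f \<in> carrier \<Gamma> \<Longrightarrow> piece_colour k cs (h \<otimes>\<^bsub>\<Gamma>\<^esub> f) = \<pi> (piece_colour k cs f)"
        using coset_translation_permutes[OF group_rotation_group S cs h] by blast
      have hM: "h \<in> carrier M" using G_carrier[OF rotation_in_G[OF h]] .
      have "?col (h ` x) = \<pi> (?col x)" if x: "x \<in> T" for x
      proof -
        obtain e where e: "e \<in> G" "x = e ` U" using x unfolding tiling_eq by blast
        obtain f where f: "f \<in> carrier \<Gamma>" "f ` D \<subseteq> x" using tile_contains_piece[OF x] by blast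
        have D: "D \<subseteq> points g" using chamber_points isometry_maps[OF mirror_isometry[OF s]] by blast
        have "h ` x = (h \<otimes>\<^bsub>M\<^esub> e) ` U"
          using isometry_image_mult[OF hM G_carrier[OF e(1)] U_points] e(2) by simp
        then have hx: "h ` x \<in> T" unfolding tiling_eq using G_mult[OF rotation_in_G[OF h] e(1)] by simp
        have "(h \<otimes>\<^bsub>\<Gamma>\<^esub> f) ` D = h ` f ` D"
          using isometry_image_mult[OF hM G_carrier[OF rotation_in_G[OF f(1)]] D] by (simp add: rotation_group_mult)
        then have "(h \<otimes>\<^bsub>\<Gamma>\<^esub> f) ` D \<subseteq> h ` x" using image_mono[OF f(2)] by simp
        moreover have "h \<otimes>\<^bsub>\<Gamma>\<^esub> f \<in> carrier \<Gamma>"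
          using group.is_monoid[OF group_rotation_group] h f(1) by (simp add: monoid.m_closed)
        ultimately have "?col (h ` x) = piece_colour k cs (h \<otimes>\<^bsub>\<Gamma>\<^esub> f)" using col[OF hx] by simp
        then show ?thesis using \<pi>(2)[OF f(1)] col[OF x f] by simp
      qed
      then show ?thesis using \<pi>(1) by blast
    qed
    ultimately show ?thesis by (simp add: perfect_colouring_def)
  qed
  then have "induces_perfect_colouring \<Gamma> D k cs T \<longleftrightarrow> agree"
    unfolding induces_perfect_colouring_def agree_def[symmetric] by (intro iffI conjI) simp_all
  then show ?thesis
    using piece_colours_agree_iff[OF S cs] unfolding agree_def by (simp add: rotation_group_mult)
qed

end

section \<open>Triangles with angles that are submultiples of \<open>\<pi>\<close>\<close>

datatype side = Side_a | Side_b | Side_c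

text \<open>
  The angle at \<open>P\<close> is enclosed by the mirrors of \<open>b\<close> and \<open>c\<close>, the one at \<open>Q\<close> by those of \<open>a\<close> and \<open>b\<close>,
  and the right angle at \<open>R\<close> by those of \<open>a\<close> and \<open>c\<close>.
\<close>

locale coxeter_triangle =
  fixes p q :: nat and g :: geometry and P Q R :: "real^3" and a b c :: isom
  assumes order_p: "p \<ge> 2" and order_q: "q \<ge> 2"
    and triangle: "nondegenerate_triangle g P Q R"
    and angle_P: "geo_angle g P Q R = pi / real p"
    and angle_Q: "geo_angle g Q P R = pi / real q"
    and angle_R: "geo_angle g R P Q = pi / 2"
    and reflection_a: "is_reflection g (geo_line g Q R) a"
    and reflection_b: "is_reflection g (geo_line g P Q) b"
    and reflection_c: "is_reflection g (geo_line g P R) c"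
begin

primrec generator :: "side \<Rightarrow> isom" where
  "generator Side_a = a"
| "generator Side_b = b"
| "generator Side_c = c"

primrec normal :: "side \<Rightarrow> real^3" where
  "normal Side_a = cross3 Q R"
| "normal Side_b = cross3 P Q"
| "normal Side_c = cross3 R P"

definition normal_square :: "side \<Rightarrow> real" where
  "normal_square i = normal i \<bullet> raise g (normal i)"

text \<open>
  The normalised covector of a side, with the sign that makes it positive on the opposite vertex:
  the vertices in \<open>normal\<close> are ordered cyclically, so the sign is the orientation of the triangle for
  all three sides.
\<close>

definition inward :: "side \<Rightarrow> real^3" where
  "inward i = (orientation P Q R / sqrt (normal_square i)) *\<^sub>R normal i"

definition mirror_order :: "side \<Rightarrow> side \<Rightarrow> nat" where
  "mirror_order i j = (if {i, j} = {Side_a, Side_b} then q else if {i, j} = {Side_b, Side_c} then p else 2)"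

lemma vertices: "P \<in> points g" "Q \<in> points g" "R \<in> points g" and oriented: "orientation P Q R \<noteq> 0"
  using triangle by (auto simp: nondegenerate_triangle_def)

lemma orientation_square: "orientation P Q R * orientation P Q R = 1"
  using oriented by (auto simp: orientation_def sgn_if)

lemma orientation_cancel: "orientation P Q R * (orientation P Q R * r) = r"
  unfolding mult.assoc[symmetric] orientation_square by (rule mult_1)

lemma orientation_det_pos: "orientation P Q R * det (vector [P, Q, R] :: real^3^3) > 0"
  using oriented by (auto simp: orientation_def sgn_if)

lemma normal_inner_combination:
  "normal i \<bullet> (u *\<^sub>R P + v *\<^sub>R Q + w *\<^sub>R R) =
    (case i of Side_a \<Rightarrow> u | Side_b \<Rightarrow> w | Side_c \<Rightarrow> v) * det (vector [P, Q, R] :: real^3^3)"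
  by (cases i) (simp_all add: coords3 det_3 algebra_simps)

lemma normal_nonzero: "normal i \<noteq> 0"
  using normal_inner_combination[of i 1 1 1] orientation_det_pos by (cases i) auto

lemma normal_square_pos: "normal_square i > 0"
  unfolding normal_square_def
proof (cases i)
  case Side_a
  then show "normal i \<bullet> raise g (normal i) > 0"
    using inner_raise_pos[OF vertices(2), of "normal i"] normal_nonzero[of i] by (simp add: orthogonal_normal)
next
  case Side_b
  then show "normal i \<bullet> raise g (normal i) > 0"
    using inner_raise_pos[OF vertices(1), of "normal i"] normal_nonzero[of i] by (simp add: orthogonal_normal)
next
  case Side_c
  then show "normal i \<bullet> raise g (normal i) > 0"
    using inner_raise_pos[OF vertices(1), of "normal i"] normal_nonzero[of i] by (simp add: orthogonal_normal)
qed

lemma inward_raise: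
  "inward i \<bullet> raise g (inward j) = (normal i \<bullet> raise g (normal j)) / (sqrt (normal_square i) * sqrt (normal_square j))"
  unfolding inward_def raise_scale inner_scaleR_left inner_scaleR_right
  by (simp add: orientation_cancel)

lemma inward_unit: "inward i \<bullet> raise g (inward i) = 1"
  using normal_square_pos[of i] by (simp add: inward_raise normal_square_def[symmetric])

lemma raise_minus: "raise g (- w) = - raise g w"
  by (simp add: vec_eq_iff forall_3)

text \<open>
  Inward normals of adjacent sides enclose the supplement of the interior angle. In the formulas this
  comes from \<open>cos_geo_angle\<close>, which takes both sides as starting from the common vertex, whereas in
  the cyclic order one of them ends there.
\<close>

lemma inward_angles:
  "inward Side_b \<bullet> raise g (inward Side_c) = - cos (pi / real p)"
  "inward Side_a \<bullet> raise g (inward Side_b) = - cos (pi / real q)"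
  "inward Side_a \<bullet> raise g (inward Side_c) = - cos (pi / 2)"
proof -
  have ne: "orientation Q P R \<noteq> 0" "orientation R P Q \<noteq> 0"
    using oriented by (auto simp: orientation_def sgn_if det_3 algebra_simps split: if_splits)
  have flip: "cross3 P R = - normal Side_c" "cross3 Q P = - normal Side_b" "cross3 R Q = - normal Side_a"
    by (simp_all add: cross_skew[of P R] cross_skew[of Q P] cross_skew[of R Q])
  have "cos (geo_angle g P Q R) = - (inward Side_b \<bullet> raise g (inward Side_c))"
    unfolding cos_geo_angle[OF vertices oriented] inward_raise flip
    by (simp add: normal_square_def raise_minus)
  then show "inward Side_b \<bullet> raise g (inward Side_c) = - cos (pi / real p)"
    unfolding angle_P by simp
  have "cos (geo_angle g Q P R) = - (inward Side_b \<bullet> raise g (inward Side_a))"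
    unfolding cos_geo_angle[OF vertices(2,1,3) ne(1)] inward_raise flip
    by (simp add: normal_square_def raise_minus)
  then show "inward Side_a \<bullet> raise g (inward Side_b) = - cos (pi / real q)"
    unfolding angle_Q inner_raise_commute[of "inward Side_a"] by simp
  have "cos (geo_angle g R P Q) = - (inward Side_c \<bullet> raise g (inward Side_a))"
    unfolding cos_geo_angle[OF vertices(3,1,2) ne(2)] inward_raise flip
    by (simp add: normal_square_def raise_minus)
  then show "inward Side_a \<bullet> raise g (inward Side_c) = - cos (pi / 2)"
    unfolding angle_R inner_raise_commute[of "inward Side_a"] by linarith
qed

sublocale mirror_system "\<lambda>i x. inward i \<bullet> x" "\<lambda>i. raise g (inward i)" mirror_order
proof
  fix i j :: side
  show "inward i \<bullet> (x + y) = inward i \<bullet> x + inward i \<bullet> y" for x y by (rule inner_add_right)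
  show "inward i \<bullet> (r *\<^sub>R x) = r *\<^sub>R (inward i \<bullet> x)" for r x by simp
  show "inward i \<bullet> raise g (inward i) = 1" by (rule inward_unit)
  show "mirror_order i j = mirror_order j i" by (simp add: mirror_order_def insert_commute)
  show "mirror_order i j \<ge> 2" using order_p order_q by (simp add: mirror_order_def)
  show "inward i \<bullet> raise g (inward j) = - cos (pi / real (mirror_order i j))" if "i \<noteq> j"
    using that inward_angles inner_raise_commute[of "inward i" g "inward j"]
    by (cases i; cases j; simp add: mirror_order_def doubleton_eq_iff)
qed

lemma generator_eq_mirror:
  assumes "x \<in> points g" shows "generator i x = mirror i x"
proof -
  have line: "U \<in> geo_line g U V" "V \<in> geo_line g U V" if "U \<in> points g" "V \<in> points g" for U V
    using that by (simp_all add: geo_line_def span_base)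
  have "generator i x = x - (2 * (normal i \<bullet> x) / (normal i \<bullet> raise g (normal i))) *\<^sub>R raise g (normal i)"
  proof (cases i)
    case Side_a
    then show ?thesis
      using reflection_formula[OF reflection_a line vertices(2,3) _ _ assms] vertices normal_nonzero[of i] by simp
  next
    case Side_b
    then show ?thesis
      using reflection_formula[OF reflection_b line vertices(1,2) _ _ assms] vertices normal_nonzero[of i] by simp
  next
    case Side_c
    then show ?thesis
      using reflection_formula[OF reflection_c line(2,1) vertices(3,1) _ _ assms] vertices normal_nonzero[of i] by simp
  qed
  also have "\<dots> = mirror i x"
    using normal_square_pos[of i] unfolding mirror_def unfolding inward_def raise_scale
    by (simp add: orientation_square normal_square_def[symmetric])
  finally show ?thesis .
qed

lemma generator_isometry: "generator i \<in> carrier (isometry_group g)"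
  using reflection_a reflection_b reflection_c by (cases i) (simp_all add: is_reflection_def)

lemma generators_carrier: "{a, b, c} \<subseteq> carrier (isometry_group g)"
  using generator_isometry[of Side_a] generator_isometry[of Side_b] generator_isometry[of Side_c] by simp

lemma generators: "s \<in> {a, b, c} \<longleftrightarrow> (\<exists>i. s = generator i)"
proof
  assume "s \<in> {a, b, c}"
  then consider "s = generator Side_a" | "s = generator Side_b" | "s = generator Side_c" by auto
  then show "\<exists>i. s = generator i" by cases blast+
next
  assume "\<exists>i. s = generator i"
  then obtain i where "s = generator i" by (elim exE)
  then show "s \<in> {a, b, c}" by (cases i) simp_all
qed

lemma generator_involution:
  "generator i \<otimes>\<^bsub>isometry_group g\<^esub> generator i = \<one>\<^bsub>isometry_group g\<^esub>"
proof -
  interpret M: group "isometry_group g" by (rule group_isometry_group)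
  show ?thesis
  proof (rule isometry_eqI)
    fix x assume x: "x \<in> points g"
    then have "generator i x \<in> points g" by (rule isometry_maps[OF generator_isometry])
    then show "(generator i \<otimes>\<^bsub>isometry_group g\<^esub> generator i) x = \<one>\<^bsub>isometry_group g\<^esub> x"
      using x by (simp add: isometry_mult generator_isometry isometry_one generator_eq_mirror mirror_mirror)
  qed (simp_all add: generator_isometry)
qed

lemma generated_isometry_eq_act:
  assumes "u \<in> generate (isometry_group g) {a, b, c}"
  shows "\<exists>w. \<forall>x\<in>points g. u x = act w x"
proof -
  interpret M: group "isometry_group g" by (rule group_isometry_group)
  have involution: "s \<otimes>\<^bsub>isometry_group g\<^esub> s = \<one>\<^bsub>isometry_group g\<^esub>" if s: "s \<in> {a, b, c}" for s
  proof -
    obtain i where "s = generator i" using iffD1[OF generators s] by (elim exE)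
    then show ?thesis by (simp only: generator_involution)
  qed
  have "\<exists>ws. set ws \<subseteq> {a, b, c} \<and> u = foldr (\<otimes>\<^bsub>isometry_group g\<^esub>) ws \<one>\<^bsub>isometry_group g\<^esub>"
    by (rule M.generate_involutions_words[OF generators_carrier _ assms]) (rule involution)
  then obtain ws where ws: "set ws \<subseteq> {a, b, c}"
    "u = foldr (\<otimes>\<^bsub>isometry_group g\<^esub>) ws \<one>\<^bsub>isometry_group g\<^esub>"
    by (elim exE conjE)
  have "foldr (\<otimes>\<^bsub>isometry_group g\<^esub>) ws \<one>\<^bsub>isometry_group g\<^esub> \<in> carrier (isometry_group g) \<and>
    (\<exists>w. \<forall>x\<in>points g. foldr (\<otimes>\<^bsub>isometry_group g\<^esub>) ws \<one>\<^bsub>isometry_group g\<^esub> x = act w x)"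
    using ws(1)
  proof (induction ws)
    case Nil
    then show ?case by (auto simp: isometry_one intro: exI[of _ "[]"])
  next
    case (Cons s ws)
    define h where "h = foldr (\<otimes>\<^bsub>isometry_group g\<^esub>) ws \<one>\<^bsub>isometry_group g\<^esub>"
    obtain w where h: "h \<in> carrier (isometry_group g)" and w: "\<forall>x\<in>points g. h x = act w x"
      using Cons by (auto simp: h_def)
    have "s \<in> {a, b, c}" using Cons.prems by simp
    then obtain i where s: "s = generator i" using generators by blast
    have "(s \<otimes>\<^bsub>isometry_group g\<^esub> h) x = act (i # w) x" if x: "x \<in> points g" for x
    proof -
      have "(s \<otimes>\<^bsub>isometry_group g\<^esub> h) x = mirror i (h x)"
        unfolding s isometry_mult[OF generator_isometry h x]
        by (rule generator_eq_mirror[OF isometry_maps[OF h x]])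
      then show ?thesis using w x by simp
    qed
    then have "\<exists>w. \<forall>x\<in>points g. (s \<otimes>\<^bsub>isometry_group g\<^esub> h) x = act w x"
      by (intro exI[of _ "i # w"] ballI)
    moreover have "s \<otimes>\<^bsub>isometry_group g\<^esub> h \<in> carrier (isometry_group g)"
      using h generator_isometry s by simp
    ultimately show ?case by (simp add: h_def)
  qed
  then show ?thesis by (simp add: ws(2))
qed

lemma inward_inner_combination:
  "inward i \<bullet> (u *\<^sub>R P + v *\<^sub>R Q + w *\<^sub>R R) =
    (case i of Side_a \<Rightarrow> u | Side_b \<Rightarrow> w | Side_c \<Rightarrow> v) *
    (orientation P Q R * det (vector [P, Q, R] :: real^3^3) / sqrt (normal_square i))"
  unfolding inward_def inner_scaleR_left normal_inner_combination by simp

lemma inward_height_pos: "orientation P Q R * det (vector [P, Q, R] :: real^3^3) / sqrt (normal_square i) > 0"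
  using orientation_det_pos normal_square_pos[of i] by (intro divide_pos_pos) simp_all

lemma triangle_inward_nonneg:
  assumes "x \<in> geo_triangle g P Q R" shows "inward i \<bullet> x \<ge> 0"
proof -
  obtain u v w where *: "u \<ge> 0" "v \<ge> 0" "w \<ge> 0" and x: "x = u *\<^sub>R P + v *\<^sub>R Q + w *\<^sub>R R"
    using assms by (auto simp: geo_triangle_def)
  show ?thesis
    unfolding x inward_inner_combination
    by (rule mult_nonneg_nonneg[OF _ less_imp_le[OF inward_height_pos]]) (use * in \<open>auto split: side.split\<close>)
qed

text \<open>
  On the model every element of the group acts as a word in the three linear reflections. If it moves
  the interior point \<open>x0\<close> into the triangle, the word satisfies the conditions of
  \<open>chamber_translate_trivial\<close>.
\<close>

theorem kaleidoscope_triangle: "\<exists>x0. kaleidoscope g a b c (geo_triangle g P Q R) x0"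
proof -
  obtain r where r: "r > 0" "r *\<^sub>R (P + Q + R) \<in> points g"
    using triangle_interior_point[OF triangle] by blast
  define x0 where "x0 = r *\<^sub>R P + r *\<^sub>R Q + r *\<^sub>R R"
  have x0: "x0 \<in> points g" using r(2) by (simp add: x0_def scaleR_add_right)
  have pos: "inward i \<bullet> x0 > 0" for i
    unfolding x0_def inward_inner_combination
    by (rule mult_pos_pos[OF _ inward_height_pos]) (use r(1) in \<open>auto split: side.split\<close>)
  interpret M: group "isometry_group g" by (rule group_isometry_group)
  have "kaleidoscope g a b c (geo_triangle g P Q R) x0"
  proof
    fix s assume "s \<in> {a, b, c}"
    then obtain i where s: "s = generator i" using generators by blast
    show "s \<in> carrier (isometry_group g)" by (simp add: s generator_isometry)
    show "s \<otimes>\<^bsub>isometry_group g\<^esub> s = \<one>\<^bsub>isometry_group g\<^esub>" by (simp add: s generator_involution)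
    fix x y z assume "x \<in> points g" "y \<in> points g" "z \<in> points g"
    then show "orientation (s x) (s y) (s z) = - orientation x y z"
      using orientation_reflect[OF inward_unit]
      by (simp add: s generator_eq_mirror mirror_def reflect_def)
  next
    show "\<exists>x\<in>points g. \<exists>y\<in>points g. \<exists>z\<in>points g. orientation x y z \<noteq> 0"
      using vertices oriented by blast
    show "geo_triangle g P Q R \<subseteq> points g" by (auto simp: geo_triangle_def)
    have "r \<ge> 0" using r(1) by simp
    then show "x0 \<in> geo_triangle g P Q R"
      using x0 unfolding geo_triangle_def x0_def by blast
  next
    fix u assume u: "u \<in> generate (isometry_group g) {a, b, c}" "u x0 \<in> geo_triangle g P Q R"
    obtain w where w: "\<forall>x\<in>points g. u x = act w x" using generated_isometry_eq_act[OF u(1)] by blast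
    have "act w = id"
      by (rule chamber_translate_trivial[OF pos]) (use w x0 u(2) triangle_inward_nonneg in simp)
    then have fixes_points: "u x = x" if "x \<in> points g" for x using w that by simp
    have uM: "u \<in> carrier (isometry_group g)"
      using M.generate_in_carrier[OF generators_carrier u(1)] .
    show "u = \<one>\<^bsub>isometry_group g\<^esub>"
      by (rule isometry_eqI[OF uM M.one_closed]) (simp add: fixes_points isometry_one)
  qed
  then show ?thesis by blast
qed

end

theorem lemma4p1:
  fixes p q k :: nat
    and g :: geometry
    and P Q R :: "real^3"
    and F :: "(real^3) set"
    and a b c :: "real^3 \<Rightarrow> real^3"
    and \<Gamma> :: "(real^3 \<Rightarrow> real^3) monoid"
    and S :: "(real^3 \<Rightarrow> real^3) set"
    and cs :: "nat \<Rightarrow> (real^3 \<Rightarrow> real^3) set"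
  assumes "p \<ge> 3" and "q \<ge> 3"
    and "g = geometry_of p q"
    and "nondegenerate_triangle g P Q R"
    and "geo_angle g P Q R = pi / real p"
    and "geo_angle g Q P R = pi / real q"
    and "geo_angle g R P Q = pi / 2"
    and "F = geo_triangle g P Q R"
    and "is_reflection g (geo_line g Q R) a"
    and "is_reflection g (geo_line g P Q) b"
    and "is_reflection g (geo_line g P R) c"
    and "\<Gamma> = rotation_group g a b c"
    and "subgroup S \<Gamma>"
    and "finite (lcosets\<^bsub>\<Gamma>\<^esub> S)" and "card (lcosets\<^bsub>\<Gamma>\<^esub> S) = k"
    and "coset_enumeration \<Gamma> S k cs"
  shows "(induces_perfect_colouring \<Gamma> (F \<union> a ` F) k cs (tiling_qp g a b c F)
            \<longleftrightarrow> a \<otimes>\<^bsub>\<Gamma>\<^esub> b \<in> S) \<and>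
         (induces_perfect_colouring \<Gamma> (F \<union> a ` F) k cs (tiling_laves g a b c F)
            \<longleftrightarrow> a \<otimes>\<^bsub>\<Gamma>\<^esub> c \<in> S) \<and>
         (induces_perfect_colouring \<Gamma> (F \<union> b ` F) k cs (tiling_pq g a b c F)
            \<longleftrightarrow> b \<otimes>\<^bsub>\<Gamma>\<^esub> c \<in> S)"
proof -
  interpret coxeter_triangle p q g P Q R a b c
    by (rule coxeter_triangle.intro[OF _ _ assms(4-7,9-11)]) (use assms(1,2) in simp_all)
  obtain x0 where "kaleidoscope g a b c F x0"
    using kaleidoscope_triangle assms(8) by blast
  then interpret K: kaleidoscope g a b c F x0 .
  have \<Gamma>: "\<Gamma> = K.\<Gamma>" by (rule assms(12))
  have S: "subgroup S K.\<Gamma>" and cs: "coset_enumeration K.\<Gamma> S k cs"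
    using assms(13,16) unfolding \<Gamma> .
  have main: "induces_perfect_colouring K.\<Gamma> (F \<union> s ` F) k cs (tiling g a b c F {s, t})
      \<longleftrightarrow> s \<otimes>\<^bsub>K.\<Gamma>\<^esub> t \<in> S" if "s \<in> {a, b, c}" "t \<in> {a, b, c}" for s t
  proof -
    interpret kaleidoscope_tile g a b c F x0 s t by unfold_locales (fact that)+
    show ?thesis by (rule induces_perfect_colouring_iff[OF S cs])
  qed
  show ?thesis
    unfolding \<Gamma> tiling_qp_def tiling_laves_def tiling_pq_def
    by (intro conjI main) simp_all
qed

end
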